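(* Let $K$ be a convex body in $\mathbb{R}^3$. Then there exists a linear bijection $T:\mathbb{R}^3\to\mathbb{R}^3$ such that $$\mathrm{Vol}(TK)\ \ge\ \frac{\sqrt{2}}{12}\,\mathrm{Diam}(TK)^3 .$$
   Context: A convex body in $\mathbb{R}^n$ is a compact convex set with non-empty interior. $\mathrm{Vol}$ denotes volume (Lebesgue measure) and $\mathrm{Diam}$ denotes the Euclidean diameter. *)

theory Defs
  imports "HOL-Analysis.Analysis"
begin

definition convex_body :: "'a::euclidean_space set \<Rightarrow> bool" where
  "convex_body K \<longleftrightarrow> compact K \<and> convex K \<and> interior K \<noteq> {}"

end

theory Submission
  imports Defs
begin

text \<open>
Let \<open>D = K - K\<close>. The diameter of \<open>T ` K\<close> is at most \<open>1\<close> iff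
\<open>T\<close> maps \<open>D\<close> into the unit ball. Among these maps, take one of largest determinant
(\<open>exists_extremal_position\<close>); equivalently, the unit ball becomes the ellipsoid of least volume
around the image of \<open>D\<close>. From now on \<open>K\<close> and \<open>D\<close> denote the images.

By the contact point condition of John and the theorem of Caratheodory
(\<open>extremal_position_decomposition\<close>), there are at most six unit vectors \<open>u\<close> in
\<open>D\<close> and weights \<open>c u\<close> with sum \<open>3\<close> such that \<open>\<Sum> c u * (u
\<bullet> x)\<^sup>2 = x \<bullet> x\<close>. A vector \<open>u\<close> of \<open>D\<close> is a difference of
two points of \<open>K\<close>, so \<open>K\<close> contains a translate of the segment from \<open>0\<close> to
\<open>u\<close>. A convex body that contains translates of three segments has at least the volume of the
simplex spanned by them (\<open>measure_ge_triple_product\<close>). So it is enough to find three vectors of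
\<open>D\<close> whose determinant has absolute value at least \<open>1 / sqrt 2\<close>, since \<open>1 / (6 *
sqrt 2) = sqrt 2 / 12\<close>.

Averaging over all triples is not enough: it only gives a squared determinant of \<open>2/5\<close>. Instead,
fix a contact vector \<open>a\<close> of largest weight \<open>h\<close>, which is at least \<open>1/2\<close>,
and project the other five to the plane orthogonal to \<open>a\<close>. They again decompose the identity there,
so the weighted sum of the squared areas over their ten pairs is \<open>1\<close>
(\<open>isotropic_triple_products\<close>). On the other hand, if \<open>m\<close> is the largest area, that sum
is at most \<open>2 * m\<^sup>2\<close> (\<open>energy_le_2\<close>). Hence \<open>m\<^sup>2 \<ge> 1/2\<close>.

The planar estimate is the heart of the proof. The sum is convex in each vector, which pushes the vectors to
vertices of the region where all areas are at most \<open>m\<close>. With one exception, further moves then make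
the five vectors lie in three directions, where the bound becomes an inequality between three numbers
(\<open>three_class_bound\<close>). The exception is a pentagon of vectors in which all non-neighbours span area
\<open>m\<close>; its five remaining areas are related by \<open>x\<^sub>i = 1 - x\<^sub>i\<^sub>-\<^sub>1 *
x\<^sub>i\<^sub>+\<^sub>1\<close> after scaling to \<open>m = 1\<close>, and this bounds the sum by an average
over degenerate pentagons, whose vectors do lie in three directions (\<open>pentagon_bound\<close>). The bound
\<open>2\<close> is attained for weights \<open>1/2\<close>, where the six vectors have the directions of the
edges of a regular simplex.
\<close>

section \<open>Weighted squared areas of five vectors in the plane\<close>

text \<open>Write \<open>x\<close> for the class that is at most \<open>h\<close> and \<open>C = 3 - h\<close>.
Balancing the other two classes gives the upper bound \<open>(C - x) * (C + 3 * x) / 4\<close>, which increases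
up to \<open>x = C / 3\<close>. At \<open>x = h\<close> its value is \<open>9/4 - h\<^sup>2\<close>, and this is
the place where \<open>1/2 \<le> h\<close> gives exactly the constant \<open>2\<close>. When \<open>h\<close>
exceeds \<open>C / 3\<close>, that is \<open>3/4\<close>, the maximal value \<open>C\<^sup>2 / 3\<close> is
itself below \<open>2\<close>.\<close>

lemma three_class_bound:
  fixes g1 g2 g3 h :: real
  assumes "0 \<le> g1" "0 \<le> g2" "0 \<le> g3" "g1 + g2 + g3 = 3 - h" "1/2 \<le> h"
    and single: "g1 \<le> h \<or> g2 \<le> h \<or> g3 \<le> h"
  shows "g1 * g2 + g1 * g3 + g2 * g3 \<le> 2"
proof -
  have key: "y * z + x * (y + z) \<le> 2" if "0 \<le> x" "x \<le> h" "x + y + z = 3 - h" for x y z :: real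
  proof -
    have s: "y + z = 3 - h - x" using that by simp
    have "4 * (y * z) \<le> (y + z)\<^sup>2" using sum_squares_ge_zero[of "y - z" 0]
      by (simp add: power2_eq_square algebra_simps)
    then have "4 * (y * z + x * (y + z)) \<le> (3 - h - x) * (3 - h + 3 * x)"
      unfolding s by (simp add: power2_eq_square algebra_simps)
    also have "\<dots> \<le> 8"
    \<comment> \<open>For h at most 3/4 the interval [0, h] lies to the left of the maximum at (3 - h)/3.\<close>
    proof (cases "h \<le> 3/4")
      case True
      have "9 - 4 * h\<^sup>2 - (3 - h - x) * (3 - h + 3 * x) = (h - x) * (6 - 5 * h - 3 * x)"
        by (simp add: power2_eq_square algebra_simps)
      moreover have "0 \<le> (h - x) * (6 - 5 * h - 3 * x)" using that True by (intro mult_nonneg_nonneg) auto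
      moreover have "(1/2)\<^sup>2 \<le> h\<^sup>2" using assms by (intro power_mono) auto
      ultimately show ?thesis by (simp add: power2_eq_square)
    next
      case False
      have "(3 - h - x) * (3 - h + 3 * x) = 4/3 * (3 - h)\<^sup>2 - 3 * (x - (3 - h) / 3)\<^sup>2"
        by (simp add: power2_eq_square field_simps)
      also have "\<dots> \<le> 4/3 * (3 - h)\<^sup>2" by simp
      also have "\<dots> \<le> 4/3 * (9/4)\<^sup>2"
      proof -
        have "0 \<le> 3 - h" using assms by linarith
        then show ?thesis using False by (intro mult_left_mono power_mono) auto
      qed
      finally show ?thesis by (simp add: power2_eq_square)
    qed
    finally show ?thesis by simp
  qed
  from single show ?thesis
  proof (elim disjE)
    assume "g1 \<le> h" then show ?thesis using key[of g1 g2 g3] assms by (simp add: algebra_simps)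
  next
    assume "g2 \<le> h" then show ?thesis using key[of g2 g1 g3] assms by (simp add: algebra_simps)
  next
    assume "g3 \<le> h" then show ?thesis using key[of g3 g1 g2] assms by (simp add: algebra_simps)
  qed
qed

text \<open>In a decomposition of the identity of three-space into at most six weighted rank-one projections,
the weights sum to \<open>3\<close>, so the largest one, \<open>h\<close>, is at least \<open>1/2\<close>. The
predicate describes the five weights that are left after removing \<open>h\<close>.\<close>

definition admissible :: "real \<Rightarrow> real \<Rightarrow> real \<Rightarrow> real \<Rightarrow> real \<Rightarrow> real \<Rightarrow> bool" where
  "admissible h a b c d e \<longleftrightarrow> 1/2 \<le> h \<and> a + b + c + d + e = 3 - h \<and>
     (\<forall>w \<in> {a, b, c, d, e}. 0 \<le> w \<and> w \<le> h)"

definition wedge :: "real \<times> real \<Rightarrow> real \<times> real \<Rightarrow> real" where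
  "wedge p q = fst p * snd q - snd p * fst q"

text \<open>This is the sum of \<open>w\<^sub>i * w\<^sub>j * (wedge v\<^sub>i v\<^sub>j)\<^sup>2\<close> over
the ten pairs from the five vectors \<open>(1,0)\<close>, \<open>(0,1)\<close>, \<open>p\<close>,
\<open>q\<close>, \<open>r\<close> with the weights \<open>a\<close>, \<open>b\<close>, \<open>c\<close>,
\<open>d\<close>, \<open>e\<close>; equivalently it is the determinant of \<open>\<Sum> w\<^sub>i v\<^sub>i
v\<^sub>i\<^sup>T\<close>, by the Cauchy-Binet formula.\<close>

definition energy :: "real \<Rightarrow> real \<Rightarrow> real \<Rightarrow> real \<Rightarrow> real \<Rightarrow>
    real \<times> real \<Rightarrow> real \<times> real \<Rightarrow> real \<times> real \<Rightarrow> real" where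
  "energy a b c d e p q r = a * b
     + c * (a * (snd p)\<^sup>2 + b * (fst p)\<^sup>2)
     + d * (a * (snd q)\<^sup>2 + b * (fst q)\<^sup>2)
     + e * (a * (snd r)\<^sup>2 + b * (fst r)\<^sup>2)
     + c * d * (wedge p q)\<^sup>2 + c * e * (wedge p r)\<^sup>2 + d * e * (wedge q r)\<^sup>2"

lemma wedge_sq_commute: "(wedge p q)\<^sup>2 = (wedge q p)\<^sup>2"
  by (simp add: wedge_def power2_eq_square algebra_simps)

lemma energy_swap12: "energy a b c d e p q r = energy a b d c e q p r"
  unfolding energy_def wedge_sq_commute[of q p] by algebra

lemma energy_swap13: "energy a b c d e p q r = energy a b e d c r q p"
  unfolding energy_def wedge_sq_commute[of q p] wedge_sq_commute[of r p] wedge_sq_commute[of r q]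
  by algebra

lemma energy_swap23: "energy a b c d e p q r = energy a b c e d p r q"
  unfolding energy_def wedge_sq_commute[of r q] by algebra

lemma energy_reflect:
  "energy a b c d e (-x,y) (-x',y') (-x'',y'') = energy a b c d e (x,y) (x',y') (x'',y'')"
proof -
  have "(wedge (-x,y) (-x',y'))\<^sup>2 = (wedge (x,y) (x',y'))\<^sup>2" for x y x' y'
    by (simp add: wedge_def power2_eq_square algebra_simps)
  then show ?thesis unfolding energy_def by simp
qed

lemma energy_transpose:
  "energy a b c d e (x,y) (x',y') (x'',y'') = energy b a c d e (y,x) (y',x') (y'',x'')"
proof -
  have "(wedge (x,y) (x',y'))\<^sup>2 = (wedge (y,x) (y',x'))\<^sup>2" for x y x' y'
    by (simp add: wedge_def power2_eq_square algebra_simps)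
  then show ?thesis unfolding energy_def by (simp add: ac_simps)
qed

lemma energy_minus:
  "energy a b c d e (-p) q r = energy a b c d e p q r"
  "energy a b c d e p (-q) r = energy a b c d e p q r"
  "energy a b c d e p q (-r) = energy a b c d e p q r"
proof -
  have "(wedge (-p) q)\<^sup>2 = (wedge p q)\<^sup>2" "(wedge p (-q))\<^sup>2 = (wedge p q)\<^sup>2" for p q
    by (simp_all add: wedge_def power2_eq_square algebra_simps)
  then show "energy a b c d e (-p) q r = energy a b c d e p q r"
    "energy a b c d e p (-q) r = energy a b c d e p q r"
    "energy a b c d e p q (-r) = energy a b c d e p q r"
    unfolding energy_def by simp_all
qed

definition sym_convex :: "(real \<times> real) set \<Rightarrow> bool" where
  "sym_convex S \<longleftrightarrow> convex S \<and> (\<forall>p\<in>S. - p \<in> S)"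

lemma convex_sublevel:
  fixes f :: "'a::real_vector \<Rightarrow> real"
  assumes "convex_on UNIV f"
  shows "convex {x. f x \<le> M}"
proof (rule convexI)
  fix x y :: 'a and u v :: real
  assume h: "x \<in> {x. f x \<le> M}" "y \<in> {x. f x \<le> M}" "0 \<le> u" "0 \<le> v" "u + v = 1"
  have "f (u *\<^sub>R x + v *\<^sub>R y) \<le> max (f x) (f y)"
    using h by (intro convex_lower[OF assms]) auto
  then show "u *\<^sub>R x + v *\<^sub>R y \<in> {x. f x \<le> M}" using h by simp
qed

text \<open>As a function of one of its vectors, the energy is a constant plus a nonnegative combination of
squares of linear forms. Hence a bound for the energy only has to be checked at the vertices of the polygon in
which that vector is confined.\<close>

lemma energy_sublevel1:
  assumes "0 \<le> a" "0 \<le> b" "0 \<le> c" "0 \<le> d" "0 \<le> e"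
  shows "sym_convex {p. energy a b c d e p q r \<le> M}"
proof -
  have sq: "convex_on UNIV (\<lambda>p. k * (l p)\<^sup>2)" if "0 \<le> k" "linear l" for k and l :: "real \<times> real \<Rightarrow> real"
  proof (intro convex_onI)
    fix t :: real and x y :: "real \<times> real"
    assume t: "0 < t" "t < 1"
    have l: "l ((1 - t) *\<^sub>R x + t *\<^sub>R y) = (1 - t) * l x + t * l y"
      using that by (simp add: linear_add linear_cmul)
    have "(1 - t) * (k * (l x)\<^sup>2) + t * (k * (l y)\<^sup>2) - k * (l ((1 - t) *\<^sub>R x + t *\<^sub>R y))\<^sup>2
        = k * (t * (1 - t) * (l x - l y)\<^sup>2)"
      unfolding l by (simp add: power2_eq_square algebra_simps)
    also have "\<dots> \<ge> 0" using t that by simp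
    finally show "k * (l ((1 - t) *\<^sub>R x + t *\<^sub>R y))\<^sup>2 \<le> (1 - t) * (k * (l x)\<^sup>2) + t * (k * (l y)\<^sup>2)"
      by simp
  qed auto
  have lin: "linear (\<lambda>p::real\<times>real. fst p)" "linear (\<lambda>p::real\<times>real. snd p)" "linear (\<lambda>p. wedge p q)" "linear (\<lambda>p. wedge p r)"
    by (auto intro!: linearI simp: wedge_def algebra_simps)
  have eq: "energy a b c d e p q r =
      c * a * (snd p)\<^sup>2 + c * b * (fst p)\<^sup>2 + c * d * (wedge p q)\<^sup>2 + c * e * (wedge p r)\<^sup>2
      + energy a b 0 d e 0 q r" for p
    by (simp add: energy_def algebra_simps)
  have "convex_on UNIV (\<lambda>p. energy a b c d e p q r)"
    unfolding eq
    by (intro convex_on_add sq lin mult_nonneg_nonneg assms) (auto simp: convex_on_const)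
  then have "convex {p. energy a b c d e p q r \<le> M}"
    by (rule convex_sublevel)
  then show ?thesis by (auto simp: sym_convex_def energy_minus)
qed

text \<open>The centre of symmetry \<open>0\<close> belongs to the set, so the missing weight \<open>1 - l -
m\<close> can be put there. So a bound is only to be checked at the nonzero vertices of a polygon that contains
\<open>0\<close>.\<close>

lemma sym_convex_cone:
  assumes S: "sym_convex S" and "A \<in> S" "B \<in> S" "0 \<le> l" "0 \<le> m" "l + m \<le> 1"
  shows "l *\<^sub>R A + m *\<^sub>R B \<in> S"
proof -
  have c: "convex S" and A: "- A \<in> S" using assms by (auto simp: sym_convex_def)
  have "(1/2) *\<^sub>R A + (1/2) *\<^sub>R (-A) \<in> S" by (rule convexD[OF c \<open>A \<in> S\<close> A]) auto
  then have 0: "0 \<in> S" by simp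
  show ?thesis
  proof (cases "l + m = 0")
    case True
    then have "l = 0" "m = 0" using assms by auto
    then show ?thesis using 0 by simp
  next
    case False
    let ?k = "l + m"
    define z where "z = (l / ?k) *\<^sub>R A + (m / ?k) *\<^sub>R B"
    have "z \<in> S" unfolding z_def
      by (rule convexD[OF c]) (use assms False in \<open>auto simp flip: add_divide_distrib\<close>)
    then have "(1 - ?k) *\<^sub>R 0 + ?k *\<^sub>R z \<in> S"
      using assms 0 by (intro convexD[OF c]) auto
    then show ?thesis using False by (simp add: z_def scaleR_add_right)
  qed
qed

lemma unit_square_bound:
  assumes S: "sym_convex {v. f v \<le> M}"
    and v: "\<And>v. v \<in> {(1,0), (0,1), (1,1)} \<Longrightarrow> f v \<le> M"
    and xy: "0 \<le> x" "x \<le> 1" "0 \<le> y" "y \<le> 1"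
  shows "f (x, y) \<le> M"
proof -
  have v1: "(1,0) \<in> {v. f v \<le> M}" and v2: "(0,1) \<in> {v. f v \<le> M}" and v3: "(1,1) \<in> {v. f v \<le> M}"
    using v by blast+
  show ?thesis
  proof (cases "y \<le> x")
    case True
    then show ?thesis using sym_convex_cone[OF S v1 v3, of "x - y" y] xy by simp
  next
    case False
    then show ?thesis using sym_convex_cone[OF S v2 v3, of "y - x" x] xy by simp
  qed
qed

text \<open>The five vectors lie in three directions, and two of them from different directions have area
\<open>1\<close>. So the energy is the second elementary symmetric polynomial in the total weights of the
directions. Five vectors in three directions leave one direction with at most one vector, which is what
\<open>three_class_bound\<close> requires.\<close>

lemma energy_three_directions:
  assumes adm: "admissible h a b c d e"
    and "p \<in> {(1,0), (0,1), (1,1)}" "q \<in> {(1,0), (0,1), (1,1)}" "r \<in> {(1,0), (0,1), (1,1)}"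
  shows "energy a b c d e p q r \<le> 2"
proof -
  have nn: "0 \<le> a" "0 \<le> b" "0 \<le> c" "0 \<le> d" "0 \<le> e" "1/2 \<le> h" "a + b + c + d + e = 3 - h"
    and le: "a \<le> h" "b \<le> h" "c \<le> h" "d \<le> h" "e \<le> h"
    using adm by (auto simp: admissible_def)
  have h0: "0 \<le> h" using nn by simp
  define g where "g v = (if v = (1,0) then a else 0) + (if v = (0,1) then b else 0)
     + (if v = p then c else 0) + (if v = q then d else 0) + (if v = r then e else 0)"
    for v :: "real \<times> real"
  have 1: "energy a b c d e p q r = g (1,0) * g (0,1) + g (1,0) * g (1,1) + g (0,1) * g (1,1)"
    using assms(2-4)
    by (elim insertE emptyE)
      (simp_all add: g_def energy_def wedge_def, simp_all add: algebra_simps)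
  have 2: "g (1,0) + g (0,1) + g (1,1) = 3 - h"
    using assms(2-4) nn unfolding g_def by (elim insertE emptyE) simp_all
  have 3: "g (1,0) \<le> h \<or> g (0,1) \<le> h \<or> g (1,1) \<le> h"
    using assms(2-4) unfolding g_def by (elim insertE emptyE) (simp_all add: le h0)
  have 4: "0 \<le> g v" for v using nn by (simp add: g_def)
  show ?thesis unfolding 1 by (rule three_class_bound[OF 4 4 4 2 nn(6) 3])
qed

lemma energy_sublevel:
  assumes "admissible h a b c d e"
  shows "sym_convex {p. energy a b c d e p q r \<le> 2}"
    "sym_convex {q. energy a b c d e p q r \<le> 2}"
    "sym_convex {r. energy a b c d e p q r \<le> 2}"
proof -
  have nn: "0 \<le> a" "0 \<le> b" "0 \<le> c" "0 \<le> d" "0 \<le> e"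
    using assms by (auto simp: admissible_def)
  show "sym_convex {p. energy a b c d e p q r \<le> 2}" by (rule energy_sublevel1) (fact nn)+
  show "sym_convex {q. energy a b c d e p q r \<le> 2}" unfolding energy_swap12[of a b c d e]
    by (rule energy_sublevel1) (fact nn)+
  show "sym_convex {r. energy a b c d e p q r \<le> 2}" unfolding energy_swap13[of a b c d e]
    by (rule energy_sublevel1) (fact nn)+
qed

text \<open>Two vectors of the unit square span an area of at most \<open>1\<close> automatically, so the three
vectors can be moved to vertices of the square one after the other.\<close>

lemma energy_one_quadrant:
  assumes adm: "admissible h a b c d e"
    and "0 \<le> x1" "x1 \<le> 1" "0 \<le> y1" "y1 \<le> 1" "0 \<le> x2" "x2 \<le> 1" "0 \<le> y2" "y2 \<le> 1"
      "0 \<le> x3" "x3 \<le> 1" "0 \<le> y3" "y3 \<le> 1"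
  shows "energy a b c d e (x1,y1) (x2,y2) (x3,y3) \<le> 2"
proof -
  let ?V = "{(1,0), (0,1), (1,1)} :: (real \<times> real) set"
  have 1: "energy a b c d e p q (x3,y3) \<le> 2" if "p \<in> ?V" "q \<in> ?V" for p q
  proof (rule unit_square_bound[where f = "energy a b c d e p q"])
    show "energy a b c d e p q v \<le> 2" if "v \<in> ?V" for v
      by (rule energy_three_directions[OF adm \<open>p \<in> ?V\<close> \<open>q \<in> ?V\<close> that])
  qed (fact energy_sublevel[OF adm] assms)+
  have 2: "energy a b c d e p (x2,y2) (x3,y3) \<le> 2" if "p \<in> ?V" for p
  proof (rule unit_square_bound[where f = "\<lambda>q. energy a b c d e p q (x3,y3)"])
    show "energy a b c d e p v (x3,y3) \<le> 2" if "v \<in> ?V" for v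
      by (rule 1[OF \<open>p \<in> ?V\<close> that])
  qed (fact energy_sublevel[OF adm] assms)+
  show ?thesis
    by (rule unit_square_bound[where f = "\<lambda>p. energy a b c d e p (x2,y2) (x3,y3)"])
      (fact energy_sublevel[OF adm] assms 2)+
qed

text \<open>The numbers \<open>z\<^sub>i\<close> are the weights of five vectors in cyclic order such that any
two non-neighbours span area \<open>1\<close>, and \<open>x\<^sub>i\<close> is the area spanned by the
\<open>i\<close>-th vector and its successor. The Pluecker relations turn into \<open>x\<^sub>i = 1 -
x\<^sub>i\<^sub>-\<^sub>1 * x\<^sub>i\<^sub>+\<^sub>1\<close>, with indices modulo \<open>5\<close>. When
\<open>x0\<close> and \<open>x2\<close> are both \<open>0\<close> or \<open>1\<close>, two of the five areas
vanish in the limit, and the five vectors lie in three directions. The squares \<open>x\<^sub>i\<^sup>2\<close>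
are bounded by the bilinear interpolation of these four cases in \<open>x0\<close> and \<open>x2\<close>. The
assumption \<open>x4 \<le> x1\<close> is what makes \<open>x4\<^sup>2 \<le> x4 * x1 = 1 - x0\<close>.\<close>

lemma pentagon_bound_ordered:
  assumes adm: "admissible h z0 z1 z2 z3 z4"
    and x: "0 \<le> x0" "x0 \<le> 1" "0 \<le> x1" "x1 \<le> 1" "0 \<le> x2" "x2 \<le> 1" "0 \<le> x3" "x3 \<le> 1" "0 \<le> x4" "x4 \<le> 1"
    and fr: "x0 = 1 - x4 * x1" "x1 = 1 - x0 * x2" "x3 = 1 - x2 * x4"
    and le: "x4 \<le> x1"
  shows "z0 * z2 + z1 * z3 + z2 * z4 + z3 * z0 + z4 * z1
    + z0 * z1 * x0\<^sup>2 + z1 * z2 * x1\<^sup>2 + z2 * z3 * x2\<^sup>2 + z3 * z4 * x3\<^sup>2 + z4 * z0 * x4\<^sup>2 \<le> 2"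
proof -
  have z: "0 \<le> z0" "0 \<le> z1" "0 \<le> z2" "0 \<le> z3" "0 \<le> z4" "1/2 \<le> h" "z0 + z1 + z2 + z3 + z4 = 3 - h"
    "z0 \<le> h" "z1 \<le> h" "z2 \<le> h" "z3 \<le> h" "z4 \<le> h"
    using adm by (auto simp: admissible_def)
  have sq: "y\<^sup>2 \<le> y" if "0 \<le> y" "y \<le> 1" for y :: real
    using mult_left_le_one_le[of y y] that by (simp add: power2_eq_square)
  have b0: "x0\<^sup>2 \<le> x0" and b1: "x1\<^sup>2 \<le> 1 - x0 * x2" and b2: "x2\<^sup>2 \<le> x2"
    using sq[of x0] sq[of x1] sq[of x2] x fr(2) by linarith+
  have "x4 * x1 \<le> x4" using x by (simp add: mult_left_le)
  then have "1 - x0 \<le> x4" using fr(1) by linarith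
  then have "x2 * (1 - x0) \<le> x2 * x4" using x by (intro mult_left_mono) auto
  then have "x2 - x0 * x2 \<le> x2 * x4" by (simp add: algebra_simps)
  then have b3: "x3\<^sup>2 \<le> 1 - x2 + x0 * x2" using sq[of x3] x fr(3) by linarith
  have "x4\<^sup>2 \<le> x4 * x1" using le x by (simp add: power2_eq_square mult_left_mono)
  then have b4: "x4\<^sup>2 \<le> 1 - x0" using fr(1) by linarith
  define D where "D = z0 * z2 + z1 * z3 + z2 * z4 + z3 * z0 + z4 * z1"
  have e00: "D + z1 * z2 + z3 * z4 + z4 * z0 \<le> 2"
    using three_class_bound[of "z0 + z1" "z2 + z3" z4 h] z by (simp add: D_def algebra_simps)
  have e01: "D + z1 * z2 + z2 * z3 + z4 * z0 \<le> 2"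
    using three_class_bound[of "z0 + z1" "z3 + z4" z2 h] z by (simp add: D_def algebra_simps)
  have e10: "D + z0 * z1 + z1 * z2 + z3 * z4 \<le> 2"
    using three_class_bound[of "z2 + z3" "z4 + z0" z1 h] z by (simp add: D_def algebra_simps)
  have e11: "D + z0 * z1 + z2 * z3 + z3 * z4 \<le> 2"
    using three_class_bound[of "z1 + z2" "z4 + z0" z3 h] z by (simp add: D_def algebra_simps)
  have "D + z0 * z1 * x0\<^sup>2 + z1 * z2 * x1\<^sup>2 + z2 * z3 * x2\<^sup>2 + z3 * z4 * x3\<^sup>2 + z4 * z0 * x4\<^sup>2
     \<le> D + z0 * z1 * x0 + z1 * z2 * (1 - x0 * x2) + z2 * z3 * x2 + z3 * z4 * (1 - x2 + x0 * x2) + z4 * z0 * (1 - x0)"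
    by (intro add_mono mult_left_mono b0 b1 b2 b3 b4 mult_nonneg_nonneg z order_refl)
  also have "\<dots> = (1 - x0) * (1 - x2) * (D + z1 * z2 + z3 * z4 + z4 * z0)
      + (1 - x0) * x2 * (D + z1 * z2 + z2 * z3 + z4 * z0)
      + x0 * (1 - x2) * (D + z0 * z1 + z1 * z2 + z3 * z4)
      + x0 * x2 * (D + z0 * z1 + z2 * z3 + z3 * z4)"
    by (simp add: algebra_simps)
  also have "\<dots> \<le> (1 - x0) * (1 - x2) * 2 + (1 - x0) * x2 * 2 + x0 * (1 - x2) * 2 + x0 * x2 * 2"
    using x by (intro add_mono mult_left_mono e00 e01 e10 e11 mult_nonneg_nonneg) auto
  also have "\<dots> = 2" by (simp add: algebra_simps)
  finally show ?thesis by (simp add: D_def)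
qed

text \<open>The relations are invariant under rotation, and going twice around the pentagon in steps of two
shows that \<open>x\<^sub>i \<le> x\<^sub>i\<^sub>+\<^sub>2\<close> for at least one \<open>i\<close>.\<close>

lemma pentagon_bound:
  assumes adm: "admissible h z0 z1 z2 z3 z4"
    and x: "0 \<le> x0" "x0 \<le> 1" "0 \<le> x1" "x1 \<le> 1" "0 \<le> x2" "x2 \<le> 1" "0 \<le> x3" "x3 \<le> 1" "0 \<le> x4" "x4 \<le> 1"
    and fr: "x0 = 1 - x4 * x1" "x1 = 1 - x0 * x2" "x2 = 1 - x1 * x3" "x3 = 1 - x2 * x4" "x4 = 1 - x3 * x0"
  shows "z0 * z2 + z1 * z3 + z2 * z4 + z3 * z0 + z4 * z1
    + z0 * z1 * x0\<^sup>2 + z1 * z2 * x1\<^sup>2 + z2 * z3 * x2\<^sup>2 + z3 * z4 * x3\<^sup>2 + z4 * z0 * x4\<^sup>2 \<le> 2"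
proof -
  have adms: "admissible h z1 z2 z3 z4 z0" "admissible h z2 z3 z4 z0 z1"
     "admissible h z3 z4 z0 z1 z2" "admissible h z4 z0 z1 z2 z3"
    using adm by (auto simp: admissible_def)
  consider "x4 \<le> x1" | "x1 \<le> x3" | "x3 \<le> x0" | "x0 \<le> x2" | "x2 \<le> x4" by linarith
  then show ?thesis
  proof cases
    case 1 then show ?thesis using pentagon_bound_ordered[OF adm x fr(1,2,4)] by simp
  next
    case 2 then show ?thesis
      using pentagon_bound_ordered[OF adms(2) x(5-10) x(1-4) fr(3,4,1)] by (simp add: ac_simps)
  next
    case 3 then show ?thesis
      using pentagon_bound_ordered[OF adms(4) x(9-10) x(1-8) fr(5,1,3)] by (simp add: ac_simps)
  next
    case 4 then show ?thesis
      using pentagon_bound_ordered[OF adms(1) x(3-10) x(1-2) fr(2,3,5)] by (simp add: ac_simps)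
  next
    case 5 then show ?thesis
      using pentagon_bound_ordered[OF adms(3) x(7-10) x(1-6) fr(4,5,2)] by (simp add: ac_simps)
  qed
qed

text \<open>The half plane \<open>B * x + A * y \<le> 1\<close> cuts off the corner \<open>(1,1)\<close> of the
unit square along the segment between \<open>(1,s)\<close> and \<open>(t,1)\<close>. Each point of the remaining
pentagon lies in one of the three cones spanned by neighbouring vertices.\<close>

lemma cut_square_in_sym_convex:
  assumes S: "sym_convex S" and v: "(1,0) \<in> S" "(0,1) \<in> S" "(1,s) \<in> S" "(t,1) \<in> S"
    and st: "0 \<le> s" "s < 1" "0 \<le> t" "t < 1" "B + A * s = 1" "B * t + A = 1"
    and xy: "0 \<le> x" "x \<le> 1" "0 \<le> y" "y \<le> 1" "B * x + A * y \<le> 1"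
  shows "(x, y) \<in> S"
proof -
  consider "y \<le> s * x" | "x \<le> t * y" | "s * x \<le> y" "t * y \<le> x" by linarith
  then show ?thesis
  proof cases
    case 1
    show ?thesis
    proof (cases "s = 0")
      case True
      then show ?thesis using sym_convex_cone[OF S v(1,3), of x 0] xy 1 by simp
    next
      case False
      then show ?thesis using sym_convex_cone[OF S v(1,3), of "x - y / s" "y / s"] xy st 1
        by (simp add: divide_simps mult.commute)
    qed
  next
    case 2
    show ?thesis
    proof (cases "t = 0")
      case True
      then show ?thesis using sym_convex_cone[OF S v(2,4), of y 0] xy 2 by simp
    next
      case False
      then show ?thesis using sym_convex_cone[OF S v(2,4), of "y - x / t" "x / t"] xy st 2
        by (simp add: divide_simps mult.commute)
    qed
  next
    case 3
    have "s * t \<le> s" using st by (intro mult_left_le) auto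
    then have D: "0 < 1 - s * t" using st by linarith
    define l where "l = (x - t * y) / (1 - s * t)"
    define m where "m = (y - s * x) / (1 - s * t)"
    have nn: "0 \<le> l" "0 \<le> m" using 3 D by (auto simp: l_def m_def)
    have x: "l + m * t = x" and y: "l * s + m = y"
      using D by (simp_all add: l_def m_def divide_simps) (simp_all add: algebra_simps)
    have "l + m = l * (B + A * s) + m * (B * t + A)" using st by simp
    also have "\<dots> = B * x + A * y" unfolding x[symmetric] y[symmetric] by (simp add: algebra_simps)
    finally have "l + m \<le> 1" using xy by simp
    then show ?thesis using sym_convex_cone[OF S v(3,4) nn] by (simp add: x y)
  qed
qed

text \<open>The vector \<open>(-A, B)\<close> moves on the segment between \<open>(0,1)\<close> and \<open>(-1,
1 - s)\<close>. The former endpoint has all vectors in one quadrant. For the latter, all areas are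
\<open>0\<close>, \<open>1\<close>, \<open>s\<close> or \<open>1 - s\<close> up to sign, so the energy is convex
in \<open>s\<close>, and for \<open>s = 0\<close> and \<open>s = 1\<close> the vectors lie in three
directions.\<close>

lemma energy_two_quadrants_one_slope:
  assumes adm: "admissible h a b c d e"
    and s: "0 \<le> s" "s \<le> 1" and A: "0 \<le> A" "A \<le> 1" and B: "B + A * s = 1"
    and p: "p \<in> {(1,0), (0,1), (1,s)}" and q: "q \<in> {(1,0), (0,1), (1,s)}"
  shows "energy a b c d e p q (-A, B) \<le> 2"
proof -
  have nn: "0 \<le> a" "0 \<le> b" "0 \<le> c" "0 \<le> d" "0 \<le> e" using adm by (auto simp: admissible_def)
  note S = energy_sublevel(3)[OF adm, of p q]
  have 1: "energy a b c d e p q (0,1) \<le> 2"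
    using p q s by (elim insertE emptyE) (simp_all add: energy_one_quadrant[OF adm])
  have 2: "energy a b c d e p q (-1, 1 - s) \<le> 2"
  proof -
    \<comment> \<open>The positions of a vector at s = 0 and at s = 1.\<close>
    let ?L = "{((1,0),(1,0)), ((0,1),(0,1)), ((1,0),(1,1))} :: ((real \<times> real) \<times> (real \<times> real)) set"
    have "\<exists>v0 v1. (v0, v1) \<in> ?L \<and> v = (1 - s) *\<^sub>R v0 + s *\<^sub>R v1" if "v \<in> {(1,0), (0,1), (1,s)}" for v
    proof -
      have "\<exists>w \<in> ?L. v = (1 - s) *\<^sub>R fst w + s *\<^sub>R snd w" using that by auto
      then show ?thesis by (metis prod.collapse)
    qed
    from this[OF p] this[OF q] obtain p0 p1 q0 q1
      where L: "(p0, p1) \<in> ?L" "(q0, q1) \<in> ?L"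
        and pq: "p = (1 - s) *\<^sub>R p0 + s *\<^sub>R p1" "q = (1 - s) *\<^sub>R q0 + s *\<^sub>R q1" by metis
    have k: "0 \<le> k * (s * (1 - s))" if "0 \<le> k" for k using that s by simp
    have ks: "0 \<le> c * a * (s * (1 - s))" "0 \<le> d * a * (s * (1 - s))" "0 \<le> e * a * (s * (1 - s))"
      "0 \<le> c * d * (s * (1 - s))" "0 \<le> c * e * (s * (1 - s))" "0 \<le> d * e * (s * (1 - s))"
      by (intro k mult_nonneg_nonneg nn)+
    have conv: "energy a b c d e p q (-1, 1 - s) \<le>
       (1 - s) * energy a b c d e p0 q0 (-1,1) + s * energy a b c d e p1 q1 (-1,0)"
      unfolding pq using L ks
      by (elim insertE emptyE)
        (simp_all add: energy_def wedge_def power2_eq_square, simp_all add: algebra_simps)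
    have "energy a b c d e p0 q0 (-1,1) = energy a b c d e p0 q0 (1,1)"
      using L by (elim insertE emptyE) (simp_all add: energy_def wedge_def)
    moreover have "energy a b c d e p0 q0 (1,1) \<le> 2"
      using L by (intro energy_three_directions[OF adm]) auto
    ultimately have E0: "(1 - s) * energy a b c d e p0 q0 (-1,1) \<le> (1 - s) * 2"
      using s by (intro mult_left_mono) auto
    have "energy a b c d e p1 q1 (-1,0) = energy a b c d e p1 q1 (1,0)"
      using energy_minus(3)[of a b c d e p1 q1 "(1,0)"] by simp
    moreover have "energy a b c d e p1 q1 (1,0) \<le> 2"
      using L by (intro energy_three_directions[OF adm]) auto
    ultimately have E1: "s * energy a b c d e p1 q1 (-1,0) \<le> s * 2"
      using s by (intro mult_left_mono) auto
    show ?thesis using conv E0 E1 by simp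
  qed
  have "(1 - A) *\<^sub>R (0,1) + A *\<^sub>R (-1, 1 - s) \<in> {r. energy a b c d e p q r \<le> 2}"
    using A 1 2 by (intro sym_convex_cone[OF S]) auto
  moreover have "(1 - A) *\<^sub>R (0,1) + A *\<^sub>R (-1, 1 - s) = (-A, B)"
    using B by (simp add: algebra_simps)
  ultimately show ?thesis by simp
qed

text \<open>If \<open>A + B \<le> 1\<close>, then \<open>(-A, B)\<close> can be moved to \<open>(-1,0)\<close>
or \<open>(0,1)\<close>, which reduces to one quadrant. Otherwise the first two vectors are confined to the cut
square and can be moved to its vertices. If only one of \<open>(1,s)\<close> and \<open>(t,1)\<close> occurs,
then \<open>energy_two_quadrants_one_slope\<close> applies, after exchanging the coordinates for the latter. If
both occur, then \<open>(1,0)\<close>, \<open>(1,s)\<close>, \<open>(t,1)\<close>, \<open>(0,1)\<close>,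
\<open>(-A,B)\<close> is a pentagon in the sense of \<open>pentagon_bound\<close>.\<close>

lemma energy_two_quadrants:
  assumes adm: "admissible h a b c d e"
    and p: "0 \<le> x1" "x1 \<le> 1" "0 \<le> y1" "y1 \<le> 1" "B * x1 + A * y1 \<le> 1"
    and q: "0 \<le> x2" "x2 \<le> 1" "0 \<le> y2" "y2 \<le> 1" "B * x2 + A * y2 \<le> 1"
    and r: "0 \<le> A" "A \<le> 1" "0 \<le> B" "B \<le> 1"
  shows "energy a b c d e (x1,y1) (x2,y2) (-A,B) \<le> 2"
proof (cases "A + B \<le> 1")
  case True
  have "energy a b c d e (x1,y1) (x2,y2) (1,0) \<le> 2" "energy a b c d e (x1,y1) (x2,y2) (0,1) \<le> 2"
    using p q by (auto intro!: energy_one_quadrant[OF adm])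
  then have "-(1,0) \<in> {r. energy a b c d e (x1,y1) (x2,y2) r \<le> 2}"
    "(0,1) \<in> {r. energy a b c d e (x1,y1) (x2,y2) r \<le> 2}"
    using energy_minus(3)[of a b c d e "(x1,y1)" "(x2,y2)" "(1,0)"] by simp_all
  from sym_convex_cone[OF energy_sublevel(3)[OF adm] this r(1,3) True] show ?thesis by simp
next
  case False
  then have AB: "0 < A" "0 < B" using r by auto
  define s where "s = (1 - B) / A"
  define t where "t = (1 - A) / B"
  have sA: "B + A * s = 1" and tB: "B * t + A = 1" using AB by (simp_all add: s_def t_def)
  have st: "0 \<le> s" "s < 1" "0 \<le> t" "t < 1"
    using AB r False by (auto simp: s_def t_def divide_simps)
  let ?V = "{(1,0), (0,1), (1,s), (t,1)} :: (real \<times> real) set"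
  let ?E = "\<lambda>p q. energy a b c d e p q (-A, B)"
  have adm2: "admissible h b a c d e" using adm by (auto simp: admissible_def)
  have pent: "energy a b c d e (1,s) (t,1) (-A, B) \<le> 2" if adm: "admissible h a b c d e" for c d
  proof -
    have adm': "admissible h a c d b e" using adm by (auto simp: admissible_def)
    have "s * t \<le> s" using st by (intro mult_left_le) auto
    then have 1: "0 \<le> 1 - s * t" "1 - s * t \<le> 1" using st by auto
    have 2: "s = 1 - B * (1 - s * t)"
    proof -
      have "B * (1 - s * t) = B - s * (B * t)" by (simp add: algebra_simps)
      also have "B * t = 1 - A" using tB by simp
      finally show ?thesis using sA by (simp add: algebra_simps)
    qed
    have 3: "t = 1 - (1 - s * t) * A"
    proof -
      have "(1 - s * t) * A = A - t * (A * s)" by (simp add: algebra_simps)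
      also have "A * s = 1 - B" using sA by simp
      finally show ?thesis using tB by (simp add: algebra_simps)
    qed
    have 4: "A = 1 - t * B" "B = 1 - A * s" using sA tB by (auto simp: algebra_simps)
    have bound: "a * d + c * b + d * e + b * a + e * c
      + a * c * s\<^sup>2 + c * d * (1 - s * t)\<^sup>2 + d * b * t\<^sup>2 + b * e * A\<^sup>2 + e * a * B\<^sup>2 \<le> 2"
      by (rule pentagon_bound[OF adm' _ _ 1 _ _ _ _ _ _ 2 refl 3 4]) (use st r in auto)
    have w: "wedge (1,s) (t,1) = 1 - s * t" "wedge (1,s) (-A,B) = 1" "wedge (t,1) (-A,B) = 1"
      using sA tB by (simp_all add: wedge_def algebra_simps)
    show ?thesis using bound unfolding energy_def w by (simp add: algebra_simps)
  qed
  have vert: "?E p q \<le> 2" if pq: "p \<in> ?V" "q \<in> ?V" for p q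
  proof -
    consider "p \<in> {(1,0), (0,1), (1,s)}" "q \<in> {(1,0), (0,1), (1,s)}"
      | "p \<in> {(1,0), (0,1), (t,1)}" "q \<in> {(1,0), (0,1), (t,1)}"
      | "p = (1,s)" "q = (t,1)" | "p = (t,1)" "q = (1,s)"
      using pq by blast
    then show ?thesis
    proof cases
      case 1
      then show ?thesis using energy_two_quadrants_one_slope[OF adm _ _ _ _ sA] st r by simp
    next
      case 2
      obtain u v u' v' where uv: "p = (u,v)" "q = (u',v')" by fastforce
      have "energy b a c d e (v,u) (v',u') (-B, A) \<le> 2"
        using 2 st r tB uv by (intro energy_two_quadrants_one_slope[OF adm2, of t]) auto
      moreover have "energy a b c d e p q (-A, B) = energy b a c d e (v,u) (v',u') (B, -A)"
        unfolding uv by (rule energy_transpose)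
      ultimately show ?thesis using energy_minus(3)[of b a c d e "(v,u)" "(v',u')" "(-B,A)"] by simp
    next
      case 3 then show ?thesis using pent[OF adm] by simp
    next
      case 4
      have "admissible h a b d c e" using adm by (auto simp: admissible_def)
      from pent[OF this] show ?thesis using 4 energy_swap12[of a b c d e p q] by simp
    qed
  qed
  have q': "?E p (x2,y2) \<le> 2" if "p \<in> ?V" for p
  proof -
    have "?E p v \<le> 2" if "v \<in> ?V" for v by (rule vert[OF \<open>p \<in> ?V\<close> that])
    then have "(1,0) \<in> {v. ?E p v \<le> 2}" "(0,1) \<in> {v. ?E p v \<le> 2}"
       "(1,s) \<in> {v. ?E p v \<le> 2}" "(t,1) \<in> {v. ?E p v \<le> 2}" by blast+
    from cut_square_in_sym_convex[OF energy_sublevel(2)[OF adm] this st sA tB q] show ?thesis by simp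
  qed
  then have "(1,0) \<in> {v. ?E v (x2,y2) \<le> 2}" "(0,1) \<in> {v. ?E v (x2,y2) \<le> 2}"
     "(1,s) \<in> {v. ?E v (x2,y2) \<le> 2}" "(t,1) \<in> {v. ?E v (x2,y2) \<le> 2}" by blast+
  from cut_square_in_sym_convex[OF energy_sublevel(1)[OF adm] this st sA tB p] show ?thesis by simp
qed

text \<open>Of three vectors in the upper half plane, two lie in the same quadrant, which by a reflection is the
first one.\<close>

lemma energy_upper_half_plane:
  assumes adm: "admissible h a b c d e"
    and x: "\<bar>x1\<bar> \<le> 1" "\<bar>x2\<bar> \<le> 1" "\<bar>x3\<bar> \<le> 1"
    and y: "0 \<le> y1" "y1 \<le> 1" "0 \<le> y2" "y2 \<le> 1" "0 \<le> y3" "y3 \<le> 1"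
    and w: "\<bar>x1 * y2 - y1 * x2\<bar> \<le> 1" "\<bar>x1 * y3 - y1 * x3\<bar> \<le> 1" "\<bar>x2 * y3 - y2 * x3\<bar> \<le> 1"
  shows "energy a b c d e (x1,y1) (x2,y2) (x3,y3) \<le> 2"
proof -
  have adms: "admissible h a b c e d" "admissible h a b e d c"
    using adm by (auto simp: admissible_def)
  have third: "energy a b c d e (x1,y1) (x2,y2) (x3,y3) \<le> 2"
    if adm: "admissible h a b c d e" and "0 \<le> x1" "x1 \<le> 1" "0 \<le> x2" "x2 \<le> 1" "-1 \<le> x3" "x3 \<le> 0"
      "0 \<le> y1" "y1 \<le> 1" "0 \<le> y2" "y2 \<le> 1" "0 \<le> y3" "y3 \<le> 1"
      "x1 * y3 - y1 * x3 \<le> 1" "x2 * y3 - y2 * x3 \<le> 1"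
    for c d e x1 y1 x2 y2 x3 y3
    using energy_two_quadrants[OF adm, of x1 y1 y3 "-x3" x2 y2] that by (simp add: algebra_simps)
  have mixed: "energy a b c d e (x1,y1) (x2,y2) (x3,y3) \<le> 2"
    if x: "-1 \<le> x1" "x1 \<le> 1" "-1 \<le> x2" "x2 \<le> 1" "-1 \<le> x3" "x3 \<le> 1"
     and w: "\<bar>x1 * y2 - y1 * x2\<bar> \<le> 1" "\<bar>x1 * y3 - y1 * x3\<bar> \<le> 1" "\<bar>x2 * y3 - y2 * x3\<bar> \<le> 1"
     and two: "(0 \<le> x1 \<and> 0 \<le> x2) \<or> (0 \<le> x1 \<and> 0 \<le> x3) \<or> (0 \<le> x2 \<and> 0 \<le> x3)"
    for x1 x2 x3
  proof -
    consider "0 \<le> x1" "0 \<le> x2" "0 \<le> x3" | "0 \<le> x1" "0 \<le> x2" "x3 \<le> 0"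
      | "0 \<le> x1" "0 \<le> x3" "x2 \<le> 0" | "0 \<le> x2" "0 \<le> x3" "x1 \<le> 0" using two by linarith
    then show ?thesis
    proof cases
      case 1 then show ?thesis using x y by (intro energy_one_quadrant[OF adm])
    next
      case 2 then show ?thesis using x y w by (intro third[OF adm]) auto
    next
      case 3 
      have "energy a b c e d (x1,y1) (x3,y3) (x2,y2) \<le> 2"
        using 3 x y w by (intro third[OF adms(1)]) (auto simp: abs_le_iff algebra_simps)
      then show ?thesis using energy_swap23[of a b c d e] by simp
    next
      case 4
      have "energy a b e d c (x3,y3) (x2,y2) (x1,y1) \<le> 2"
        using 4 x y w by (intro third[OF adms(2)]) (auto simp: abs_le_iff algebra_simps)
      then show ?thesis using energy_swap13[of a b c d e] by simp
    qed
  qed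
  show ?thesis
  proof (cases "(0 \<le> x1 \<and> 0 \<le> x2) \<or> (0 \<le> x1 \<and> 0 \<le> x3) \<or> (0 \<le> x2 \<and> 0 \<le> x3)")
    case True
    then show ?thesis using x w by (intro mixed) auto
  next
    case False
    have "energy a b c d e (-x1,y1) (-x2,y2) (-x3,y3) \<le> 2"
      using False x w by (intro mixed) (auto simp: abs_le_iff algebra_simps)
    then show ?thesis by (simp add: energy_reflect)
  qed
qed

text \<open>The energy does not change when a vector is replaced by its negative, so all vectors can be assumed
to be in the upper half plane.\<close>

lemma energy_le_2:
  assumes adm: "admissible h a b c d e"
    and v: "\<And>v. v \<in> {p, q, r} \<Longrightarrow> \<bar>fst v\<bar> \<le> 1 \<and> \<bar>snd v\<bar> \<le> 1"
    and w: "\<bar>wedge p q\<bar> \<le> 1" "\<bar>wedge p r\<bar> \<le> 1" "\<bar>wedge q r\<bar> \<le> 1"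
  shows "energy a b c d e p q r \<le> 2"
proof -
  define up where "up v = (if snd v < 0 then - v else v)" for v :: "real \<times> real"
  have 1: "energy a b c d e p q r = energy a b c d e (up p) (up q) (up r)"
    by (simp add: up_def energy_minus)
  have 2: "\<bar>wedge (up u) (up v)\<bar> = \<bar>wedge u v\<bar>" for u v
    by (auto simp: up_def wedge_def abs_if)
  have 3: "\<bar>fst (up v)\<bar> = \<bar>fst v\<bar>" "snd (up v) = \<bar>snd v\<bar>" for v
    by (auto simp: up_def)
  have "energy a b c d e (fst (up p), snd (up p)) (fst (up q), snd (up q)) (fst (up r), snd (up r)) \<le> 2"
    by (rule energy_upper_half_plane[OF adm])
      (use v w 3 2[unfolded wedge_def[of "up _"]] in auto)
  then show ?thesis unfolding 1 by simp
qed

section \<open>Triple products in a decomposition of the identity\<close>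


text \<open>The form \<open>(x, y) \<mapsto> a \<bullet> cross3 x y\<close> is alternating of rank two, so that
its values satisfy the relation of the two-by-two minors of a matrix with two rows.\<close>

lemma triple_product_pluecker:
  fixes a u v x y :: "real^3"
  shows "(a \<bullet> (cross3 x v)) * (a \<bullet> (cross3 u y)) - (a \<bullet> (cross3 u x)) * (a \<bullet> (cross3 y v))
    = (a \<bullet> (cross3 u v)) * (a \<bullet> (cross3 x y))"
  by (simp add: inner_vec_def sum_3 cross3_def) algebra

text \<open>This compares the traces of the two sides of \<open>\<Sum> c\<^sub>i v\<^sub>i v\<^sub>i\<^sup>T =
I\<close>.\<close>

lemma isotropic_norm_sum:
  fixes v :: "'i \<Rightarrow> real^'n"
  assumes "finite I" and iso: "\<And>x. (\<Sum>i\<in>I. c i * (v i \<bullet> x)\<^sup>2) = x \<bullet> x"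
  shows "(\<Sum>i\<in>I. c i * (v i \<bullet> v i)) = real CARD('n)"
proof -
  have "(\<Sum>i\<in>I. c i * (v i \<bullet> v i)) = (\<Sum>i\<in>I. \<Sum>b\<in>UNIV. c i * (v i \<bullet> axis b 1)\<^sup>2)"
    by (simp add: inner_axis power2_eq_square sum_distrib_left[symmetric])
      (simp add: inner_vec_def)
  also have "\<dots> = (\<Sum>b\<in>UNIV. (axis b 1 :: real^'n) \<bullet> axis b 1)"
    by (subst sum.swap) (simp add: iso)
  also have "\<dots> = real CARD('n)" by (simp add: inner_axis)
  finally show ?thesis .
qed

text \<open>The projections of the \<open>v\<^sub>i\<close> to the plane orthogonal to \<open>a\<close> form a
decomposition of the identity of that plane. So the sum of weighted squared areas over unordered pairs is
\<open>1\<close>, the determinant of that identity.\<close>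

lemma isotropic_triple_products:
  fixes a :: "real^3" and v :: "nat \<Rightarrow> real^3"
  assumes iso: "\<And>x. h * (a \<bullet> x)\<^sup>2 + (\<Sum>i<n. c i * (v i \<bullet> x)\<^sup>2) = x \<bullet> x" and a: "norm a = 1"
  shows "(\<Sum>i<n. \<Sum>j<n. c i * c j * (a \<bullet> (cross3 (v i) (v j)))\<^sup>2) = 2"
proof -
  have aa: "a \<bullet> a = 1" using a by (simp add: norm_eq_1)
  have "(\<Sum>i<Suc n. (case i of 0 \<Rightarrow> h | Suc i \<Rightarrow> c i) *
      ((case i of 0 \<Rightarrow> a | Suc i \<Rightarrow> v i) \<bullet> (case i of 0 \<Rightarrow> a | Suc i \<Rightarrow> v i))) = real CARD(3)"
    by (rule isotropic_norm_sum) (simp_all add: sum.lessThan_Suc_shift iso del: sum.lessThan_Suc)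
  then have tr: "(\<Sum>i<n. c i * (v i \<bullet> v i)) = 3 - h"
    by (simp add: sum.lessThan_Suc_shift aa del: sum.lessThan_Suc)
  have aiso: "(\<Sum>i<n. c i * (v i \<bullet> a)\<^sup>2) = 1 - h"
    using iso[of a] aa by simp
  have inner: "(\<Sum>j<n. c i * c j * (a \<bullet> (cross3 (v i) (v j)))\<^sup>2) = c i * (v i \<bullet> v i) - c i * (v i \<bullet> a)\<^sup>2" for i
  proof -
    have t: "a \<bullet> (cross3 (v i) (v j)) = v j \<bullet> (cross3 a (v i))" for j
      by (simp add: inner_vec_def sum_3 cross3_def algebra_simps)
    have "(\<Sum>j<n. c j * (v j \<bullet> (cross3 a (v i)))\<^sup>2) = (cross3 a (v i)) \<bullet> (cross3 a (v i))"
      using iso[of "cross3 a (v i)"] by (simp add: dot_cross_self)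
    also have "\<dots> = (a \<bullet> a) * (v i \<bullet> v i) - (v i \<bullet> a)\<^sup>2"
      by (simp add: inner_vec_def sum_3 cross3_def) algebra
    finally show ?thesis
      by (simp add: t aa mult.assoc sum_distrib_left[symmetric] right_diff_distrib)
  qed
  show ?thesis by (simp add: inner sum_subtractf tr aiso)
qed

text \<open>Take the pair whose projection along \<open>a\<close> spans the largest area \<open>m\<close>, and
use it as the basis of the plane orthogonal to \<open>a\<close>. In these coordinates all areas are at most
\<open>1\<close>, so the energy is at most \<open>2\<close> by \<open>energy_le_2\<close>. But the energy equals
\<open>1 / m\<^sup>2\<close> by \<open>isotropic_triple_products\<close>.\<close>

lemma isotropic_large_triple_product:
  fixes a :: "real^3" and v :: "nat \<Rightarrow> real^3"
  assumes iso: "\<And>x. h * (a \<bullet> x)\<^sup>2 + (\<Sum>i<5. c i * (v i \<bullet> x)\<^sup>2) = x \<bullet> x" and a: "norm a = 1"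
    and adm: "1/2 \<le> h" "\<And>i. i < 5 \<Longrightarrow> 0 \<le> c i \<and> c i \<le> h" "(\<Sum>i<5. c i) = 3 - h"
  shows "\<exists>i<5. \<exists>j<5. 1/2 \<le> (a \<bullet> (cross3 (v i) (v j)))\<^sup>2"
proof -
  define T where "T i j = a \<bullet> (cross3 (v i) (v j))" for i j
  have Tself: "T i i = 0" and Tskew: "T i j = - T j i" for i j
    by (simp_all add: T_def inner_vec_def sum_3 cross3_def algebra_simps)
  have total: "(\<Sum>i<5. \<Sum>j<5. c i * c j * (T i j)\<^sup>2) = 2"
    unfolding T_def by (rule isotropic_triple_products[OF iso a])
  have Tsq: "(T i j)\<^sup>2 = (T j i)\<^sup>2" for i j
    unfolding Tskew[of i j] by simp
  let ?P = "Sigma {..<5::nat} (\<lambda>_. {..<5::nat})"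
  obtain i0 j0 where ij: "i0 < 5" "j0 < 5" and mx: "\<And>i j. i < 5 \<Longrightarrow> j < 5 \<Longrightarrow> \<bar>T i j\<bar> \<le> \<bar>T i0 j0\<bar>"
  proof -
    let ?f = "\<lambda>(i, j). \<bar>T i j\<bar>"
    have "Max (?f ` ?P) \<in> ?f ` ?P" by (rule Max_in) (auto simp: lessThan_empty_iff)
    then obtain w where w: "w \<in> ?P" "?f w = Max (?f ` ?P)" by auto
    have "?f z \<le> ?f w" if "z \<in> ?P" for z
      unfolding w(2) by (rule Max_ge) (use that in auto)
    then show thesis using that[of "fst w" "snd w"] w(1) by fastforce
  qed
  define m where "m = T i0 j0"
  have m: "m \<noteq> 0"
  proof
    assume "m = 0"
    then have "T i j = 0" if "i < 5" "j < 5" for i j using mx[OF that] by (simp add: m_def)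
    then have "(\<Sum>i<5. \<Sum>j<5. c i * c j * (T i j)\<^sup>2) = 0" by simp
    then show False using total by simp
  qed
  then have ne: "i0 \<noteq> j0" using Tself by (auto simp: m_def)
  obtain k l n where kln: "{..<5} = {i0, j0, k, l, n}" "distinct [i0, j0, k, l, n]"
  proof -
    have "card ({..<5} - {i0, j0}) = 3" using ij ne by (simp add: card_Diff_subset)
    then obtain k l n where "{..<5} - {i0, j0} = {k, l, n}" "k \<noteq> l" "l \<noteq> n" "k \<noteq> n"
      by (metis card_3_iff)
    then show thesis using that[of k l n] ij ne by auto
  qed
  have sum5: "(\<Sum>i<5. f i) = f i0 + f j0 + f k + f l + f n" for f :: "nat \<Rightarrow> real"
    using kln(2) unfolding kln(1) by (simp add: add.assoc)
  have lt: "i \<in> {i0, j0, k, l, n} \<Longrightarrow> i < 5" for i using kln(1) by auto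
  have admiss: "admissible h (c i0) (c j0) (c k) (c l) (c n)"
    unfolding admissible_def using adm lt sum5[of c] by auto
  \<comment> \<open>Coordinates of the projections with respect to the basis given by i0 and j0, by Cramer's rule.\<close>
  define w where "w i = (T i j0 / m, T i0 i / m)" for i
  have wedge_w: "wedge (w i) (w j) = T i j / m" for i j
  proof -
    have "T i j0 * T i0 j - T i0 i * T j j0 = m * T i j"
      unfolding T_def m_def by (rule triple_product_pluecker)
    then show ?thesis using m by (simp add: wedge_def w_def field_simps)
  qed
  have small: "\<bar>T i j / m\<bar> \<le> 1" if "i < 5" "j < 5" for i j
    using mx[OF that] m by (simp add: m_def divide_le_eq_1)
  have E: "energy (c i0) (c j0) (c k) (c l) (c n) (w k) (w l) (w n) \<le> 2"
  proof (rule energy_le_2[OF admiss])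
    show "\<bar>fst v\<bar> \<le> 1 \<and> \<bar>snd v\<bar> \<le> 1" if "v \<in> {w k, w l, w n}" for v
      using that small ij lt by (auto simp: w_def simp del: abs_divide)
  qed (simp_all only: wedge_w small lt insertI1 insertI2)
  have "m\<^sup>2 * energy (c i0) (c j0) (c k) (c l) (c n) (w k) (w l) (w n) = 1"
  proof -
    have "2 * (m\<^sup>2 * energy (c i0) (c j0) (c k) (c l) (c n) (w k) (w l) (w n)) =
        (\<Sum>i<5. \<Sum>j<5. c i * c j * (T i j)\<^sup>2)"
      unfolding energy_def wedge_w sum5 Tself Tsq[of j0 i0] Tsq[of k i0] Tsq[of j0 k] Tsq[of l i0] Tsq[of j0 l]
        Tsq[of n i0] Tsq[of j0 n] Tsq[of l k] Tsq[of n k] Tsq[of n l]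
      using m by (simp add: w_def power_divide m_def[symmetric]) (simp add: field_simps)
    then show ?thesis using total by simp
  qed
  then have "1 \<le> m\<^sup>2 * 2" using mult_left_mono[OF E, of "m\<^sup>2"] by simp
  then have "1/2 \<le> (T i0 j0)\<^sup>2" by (simp add: m_def)
  then show ?thesis using ij unfolding T_def by blast
qed

section \<open>The position of maximal determinant\<close>

text \<open>Five entries of the symmetric matrix \<open>u u\<^sup>T\<close>. For a unit vector they determine
the sixth one, because the trace is \<open>1\<close>. Having only five coordinates matters: the theorem of
Caratheodory then provides six points and not seven.\<close>

definition quad :: "real^3 \<Rightarrow> real \<times> real \<times> real \<times> real \<times> real" where
  "quad u = ((u$1)\<^sup>2, (u$2)\<^sup>2, u$1 * u$2, u$2 * u$3, u$1 * u$3)"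

definition sym_matrix :: "real \<Rightarrow> real \<Rightarrow> real \<Rightarrow> real \<Rightarrow> real \<Rightarrow> real \<Rightarrow> real^3^3" where
  "sym_matrix a b c d e f = vector [vector [a, d, f], vector [d, b, e], vector [f, e, c]]"

text \<open>The derivative of the determinant at the identity is the trace.\<close>

lemma det_perturbed_identity:
  fixes H :: "real^3^3"
  assumes "0 < trace H"
  shows "\<exists>\<delta>>0. \<forall>t. 0 < t \<and> t < \<delta> \<longrightarrow> 1 < det (mat 1 + t *\<^sub>R H)"
proof -
  define \<beta> where "\<beta> = H$1$1 * H$2$2 + H$1$1 * H$3$3 + H$2$2 * H$3$3 - H$1$2 * H$2$1 - H$1$3 * H$3$1 - H$2$3 * H$3$2"
  have expand: "det (mat 1 + t *\<^sub>R H) = 1 + t * (trace H + t * (\<beta> + t * det H))" for t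
    unfolding det_3 trace_def sum_3 \<beta>_def
    by (simp add: mat_def algebra_simps)
  define \<delta> where "\<delta> = min 1 (trace H / (\<bar>\<beta>\<bar> + \<bar>det H\<bar> + 1))"
  have "0 < \<delta>" using assms by (simp add: \<delta>_def add_nonneg_pos)
  moreover have "1 < det (mat 1 + t *\<^sub>R H)" if t: "0 < t" "t < \<delta>" for t
  proof -
    have t1: "t < 1" and "t < trace H / (\<bar>\<beta>\<bar> + \<bar>det H\<bar> + 1)" using t by (auto simp: \<delta>_def)
    then have "t * (\<bar>\<beta>\<bar> + \<bar>det H\<bar> + 1) < trace H" by (simp add: pos_less_divide_eq add_nonneg_pos)
    moreover have "\<bar>t * (\<beta> + t * det H)\<bar> \<le> t * (\<bar>\<beta>\<bar> + \<bar>det H\<bar>)"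
    proof -
      have "\<bar>\<beta> + t * det H\<bar> \<le> \<bar>\<beta>\<bar> + t * \<bar>det H\<bar>"
        using abs_triangle_ineq[of \<beta> "t * det H"] t by (simp add: abs_mult)
      also have "\<dots> \<le> \<bar>\<beta>\<bar> + \<bar>det H\<bar>" using t1 t by (intro add_left_mono mult_left_le_one_le) auto
      finally show ?thesis using t by (simp add: abs_mult)
    qed
    moreover have "t * (\<bar>\<beta>\<bar> + \<bar>det H\<bar> + 1) = t * (\<bar>\<beta>\<bar> + \<bar>det H\<bar>) + t" by (simp add: algebra_simps)
    ultimately have "0 < trace H + t * (\<beta> + t * det H)" using t by linarith
    then show ?thesis unfolding expand using t by simp
  qed
  ultimately show ?thesis by blast
qed

text \<open>The derivative of \<open>(norm v)\<^sup>2\<close> under the perturbation is \<open>2 * (v \<bullet>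
(H *v v))\<close>. By compactness there is an \<open>\<eta> > 0\<close> such that for each \<open>v\<close>
either the norm is smaller than \<open>1\<close> by a margin depending on \<open>\<eta>\<close>, or this
derivative is at most \<open>- 2 * \<eta>\<close>; in both cases a short step keeps the norm at most
\<open>1\<close>.\<close>

lemma contraction_perturbed_identity:
  fixes H :: "real^3^3" and D :: "(real^3) set"
  assumes D: "compact D" "\<And>v. v \<in> D \<Longrightarrow> norm v \<le> 1"
    and neg: "\<And>u. u \<in> D \<Longrightarrow> norm u = 1 \<Longrightarrow> u \<bullet> (H *v u) < 0"
  shows "\<exists>\<delta>>0. \<forall>t. 0 < t \<and> t < \<delta> \<longrightarrow> (\<forall>v\<in>D. norm ((mat 1 + t *\<^sub>R H) *v v) \<le> 1)"
proof (cases "D = {}")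
  case True
  then show ?thesis by (intro exI[of _ 1]) auto
next
  case False
  let ?g = "\<lambda>v. v \<bullet> (H *v v)"
  have cont: "continuous_on D (\<lambda>v. H *v v)"
    by (intro linear_continuous_on linear_conv_bounded_linear[THEN iffD1] matrix_vector_mul_linear)
  have "continuous_on D (\<lambda>v. max (1 - v \<bullet> v) (- ?g v))"
    by (intro continuous_intros cont)
  from continuous_attains_inf[OF D(1) False this] obtain w where w: "w \<in> D"
    and min: "\<And>v. v \<in> D \<Longrightarrow> max (1 - w \<bullet> w) (- ?g w) \<le> max (1 - v \<bullet> v) (- ?g v)" by blast
  define \<eta> where "\<eta> = max (1 - w \<bullet> w) (- ?g w)"
  have "0 < \<eta>"
  proof (cases "norm w = 1")
    case True then show ?thesis using neg[OF w] by (simp add: \<eta>_def)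
  next
    case False
    then have "norm w < 1" using D(2)[OF w] by simp
    then have "w \<bullet> w < 1" by (simp add: dot_square_norm abs_square_less_1)
    then show ?thesis by (simp add: \<eta>_def)
  qed
  obtain M where M: "\<And>v. v \<in> D \<Longrightarrow> norm (H *v v) \<le> M" and "0 < M"
  proof -
    have "bounded ((\<lambda>v. H *v v) ` D)" by (intro compact_imp_bounded compact_continuous_image cont D)
    then show thesis using that unfolding bounded_pos by auto
  qed
  define \<delta> where "\<delta> = min 1 (\<eta> / (2 * M + M\<^sup>2))"
  have MM: "0 < 2 * M + M\<^sup>2" using \<open>0 < M\<close> by (simp add: add_pos_pos)
  have "0 < \<delta>" using \<open>0 < \<eta>\<close> MM by (simp add: \<delta>_def)
  moreover have "norm ((mat 1 + t *\<^sub>R H) *v v) \<le> 1" if t: "0 < t" "t < \<delta>" and v: "v \<in> D" for t v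
  proof -
    have t1: "t < 1" and "t < \<eta> / (2 * M + M\<^sup>2)" using t by (auto simp: \<delta>_def)
    then have tM: "t * (2 * M + M\<^sup>2) < \<eta>" using MM by (simp add: pos_less_divide_eq)
    have Av: "(mat 1 + t *\<^sub>R H) *v v = v + t *\<^sub>R (H *v v)"
      by (simp add: matrix_vector_mult_add_rdistrib scaleR_matrix_vector_assoc)
    have sq: "(norm ((mat 1 + t *\<^sub>R H) *v v))\<^sup>2 = v \<bullet> v + 2 * t * ?g v + t\<^sup>2 * (norm (H *v v))\<^sup>2"
      unfolding Av power2_norm_eq_inner
      by (simp add: inner_add_left inner_add_right inner_commute[of "H *v v" v] power2_eq_square distrib_left)
    have vv: "v \<bullet> v \<le> 1" using D(2)[OF v] by (simp add: dot_square_norm abs_square_le_1)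
    have g: "?g v \<le> M"
    proof -
      have "?g v \<le> norm v * norm (H *v v)" by (rule norm_cauchy_schwarz)
      also have "\<dots> \<le> 1 * M" using D(2)[OF v] M[OF v] by (intro mult_mono) auto
      finally show ?thesis by simp
    qed
    have "(norm (H *v v))\<^sup>2 \<le> M\<^sup>2" using M[OF v] by (intro power_mono) auto
    then have "t\<^sup>2 * (norm (H *v v))\<^sup>2 \<le> t\<^sup>2 * M\<^sup>2" by (intro mult_left_mono) auto
    also have "\<dots> = t * (t * M\<^sup>2)" by (simp add: power2_eq_square)
    finally have q: "t\<^sup>2 * (norm (H *v v))\<^sup>2 \<le> t * (t * M\<^sup>2)" .
    have tq: "t * (t * M\<^sup>2) \<le> t * M\<^sup>2" using t t1 by (intro mult_left_mono mult_left_le_one_le) auto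
    have "\<eta> \<le> 1 - v \<bullet> v \<or> \<eta> \<le> - ?g v" using min[OF v] by (auto simp: \<eta>_def max_def split: if_splits)
    then have "v \<bullet> v + 2 * t * ?g v + t\<^sup>2 * (norm (H *v v))\<^sup>2 \<le> 1"
    proof
      assume "\<eta> \<le> 1 - v \<bullet> v"
      moreover have "2 * t * ?g v \<le> t * (2 * M)" using mult_left_mono[OF g, of "2 * t"] t by simp
      moreover have "t * (2 * M + M\<^sup>2) = t * (2 * M) + t * M\<^sup>2" by (simp add: algebra_simps)
      ultimately show ?thesis using q tq tM by linarith
    next
      assume "\<eta> \<le> - ?g v"
      then have "t * (2 * \<eta>) \<le> t * (2 * (- ?g v))" using t by (intro mult_left_mono) auto
      moreover have "t * (2 * (- ?g v)) = - (2 * t * ?g v)" by simp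
      moreover have "t * (t * M\<^sup>2) \<le> t * (2 * \<eta>)"
      proof (intro mult_left_mono)
        have "t * M\<^sup>2 \<le> t * (2 * M + M\<^sup>2)" using t \<open>0 < M\<close> by (intro mult_left_mono) auto
        then show "t * M\<^sup>2 \<le> 2 * \<eta>" using tM \<open>0 < \<eta>\<close> by linarith
      qed (use t in auto)
      ultimately show ?thesis using q vv by linarith
    qed
    then have "(norm ((mat 1 + t *\<^sub>R H) *v v))\<^sup>2 \<le> 1\<^sup>2" unfolding sq by simp
    then show ?thesis by (rule power2_le_imp_le) simp
  qed
  ultimately show ?thesis by blast
qed

text \<open>This is the contact point condition of John for the ellipsoid of least volume around
\<open>D\<close>. If it failed, a separating hyperplane would give a symmetric matrix \<open>H\<close> of
positive trace that decreases the norm of all contact points to first order. Then \<open>mat 1 + t *\<^sub>R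
H\<close> would contradict the maximality of the determinant.\<close>

lemma extremal_position_hull:
  fixes D :: "(real^3) set"
  assumes D: "compact D" "\<And>v. v \<in> D \<Longrightarrow> norm v \<le> 1"
    and ext: "\<And>A::real^3^3. (\<And>v. v \<in> D \<Longrightarrow> norm (A *v v) \<le> 1) \<Longrightarrow> det A \<le> 1"
  shows "(1/3, 1/3, 0, 0, 0) \<in> convex hull (quad ` (D \<inter> sphere 0 1))"
proof (rule ccontr)
  let ?z = "(1/3, 1/3, 0, 0, 0) :: real \<times> real \<times> real \<times> real \<times> real"
  let ?S = "quad ` (D \<inter> sphere 0 1)"
  assume no: "?z \<notin> convex hull ?S"
  have "continuous_on (D \<inter> sphere 0 1) quad"
    unfolding quad_def by (intro continuous_intros)
  then have "compact (convex hull ?S)"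
    by (intro compact_convex_hull compact_continuous_image compact_Int_closed D) auto
  then obtain y \<beta> where yz: "y \<bullet> ?z < \<beta>" and yS: "\<And>x. x \<in> convex hull ?S \<Longrightarrow> \<beta> < y \<bullet> x"
    using separating_hyperplane_closed_point[OF convex_convex_hull compact_imp_closed no] by blast
  obtain y1 y2 y3 y4 y5 where y: "y = (y1, y2, y3, y4, y5)" by (metis prod.collapse)
  \<comment> \<open>The normal vector y as a quadratic form, negated and shifted so that its value on unit vectors compares y with the level \<open>\<beta>\<close>.\<close>
  define H where "H = sym_matrix (\<beta> - y1) (\<beta> - y2) \<beta> (- y3 / 2) (- y4 / 2) (- y5 / 2)"
  have form: "u \<bullet> (H *v u) = \<beta> * (u \<bullet> u) - y \<bullet> quad u" for u
    by (simp add: H_def sym_matrix_def inner_vec_def matrix_vector_mult_def sum_3 vector_3 y quad_def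
        power2_eq_square field_simps)
  have "0 < trace H"
    using yz by (simp add: H_def sym_matrix_def trace_def sum_3 vector_3 y)
  then obtain \<delta>1 where \<delta>1: "0 < \<delta>1" "\<And>t. 0 < t \<Longrightarrow> t < \<delta>1 \<Longrightarrow> 1 < det (mat 1 + t *\<^sub>R H)"
    using det_perturbed_identity by blast
  have "u \<bullet> (H *v u) < 0" if "u \<in> D" "norm u = 1" for u
  proof -
    have "quad u \<in> convex hull ?S" using that by (intro hull_inc) auto
    then have "\<beta> < y \<bullet> quad u" by (rule yS)
    moreover have "u \<bullet> u = 1" using that by (simp add: norm_eq_1)
    ultimately show ?thesis by (simp add: form)
  qed
  then obtain \<delta>2 where \<delta>2: "0 < \<delta>2"
    "\<And>t v. 0 < t \<Longrightarrow> t < \<delta>2 \<Longrightarrow> v \<in> D \<Longrightarrow> norm ((mat 1 + t *\<^sub>R H) *v v) \<le> 1"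
    using contraction_perturbed_identity[OF D, of H] by blast
  define t where "t = min \<delta>1 \<delta>2 / 2"
  have t: "0 < t" "t < \<delta>1" "t < \<delta>2" using \<delta>1 \<delta>2 by (auto simp: t_def)
  have "det (mat 1 + t *\<^sub>R H) \<le> 1" by (rule ext) (rule \<delta>2(2)[OF t(1,3)])
  then show False using \<delta>1(2)[OF t(1,2)] by simp
qed

text \<open>The equations for the five entries in \<open>quad\<close>, together with the sum of the weights,
also give the sixth entry of \<open>\<Sum> c u * (u u\<^sup>T) = I\<close>.\<close>

lemma extremal_position_decomposition:
  fixes D :: "(real^3) set"
  assumes D: "compact D" "\<And>v. v \<in> D \<Longrightarrow> norm v \<le> 1"
    and ext: "\<And>A::real^3^3. (\<And>v. v \<in> D \<Longrightarrow> norm (A *v v) \<le> 1) \<Longrightarrow> det A \<le> 1"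
  shows "\<exists>U c. finite U \<and> card U \<le> 6 \<and> U \<subseteq> D \<inter> sphere 0 1 \<and> (\<forall>u\<in>U. 0 \<le> c u) \<and> sum c U = 3
     \<and> (\<forall>x. (\<Sum>u\<in>U. c u * (u \<bullet> x)\<^sup>2) = x \<bullet> x)"
proof -
  let ?z = "(1/3, 1/3, 0, 0, 0) :: real \<times> real \<times> real \<times> real \<times> real"
  let ?C = "D \<inter> sphere 0 1"
  from extremal_position_hull[OF D ext] obtain S where S: "finite S" "S \<subseteq> quad ` ?C" "card S \<le> 6" "?z \<in> convex hull S"
    unfolding caratheodory[of "quad ` ?C"] by auto
  obtain U where U: "U \<subseteq> ?C" "inj_on quad U" "S = quad ` U"
    using S(2) by (metis subset_image_inj)
  have fin: "finite U" "card U \<le> 6" using S U by (auto simp: finite_image_iff card_image)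
  from S obtain l where l: "\<forall>s\<in>S. 0 \<le> l s" "sum l S = 1" "(\<Sum>s\<in>S. l s *\<^sub>R s) = ?z"
    by (auto simp: convex_hull_finite)
  define c where "c u = 3 * l (quad u)" for u
  have sc: "sum c U = 3"
    using l(2) U by (simp add: c_def sum_distrib_left[symmetric] sum.reindex o_def)
  have "(\<Sum>u\<in>U. c u *\<^sub>R quad u) = 3 *\<^sub>R ?z"
    using l(3) U by (simp add: c_def scaleR_scaleR[symmetric] scaleR_sum_right[symmetric] sum.reindex o_def del: scaleR_scaleR)
  then have quads: "(\<Sum>u\<in>U. c u * (u$1)\<^sup>2) = 1" "(\<Sum>u\<in>U. c u * (u$2)\<^sup>2) = 1"
    "(\<Sum>u\<in>U. c u * (u$1 * u$2)) = 0" "(\<Sum>u\<in>U. c u * (u$2 * u$3)) = 0" "(\<Sum>u\<in>U. c u * (u$1 * u$3)) = 0"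
    by (simp_all add: quad_def prod_eq_iff fst_sum snd_sum)
  have "(\<Sum>u\<in>U. c u * (u$3)\<^sup>2) = (\<Sum>u\<in>U. c u - c u * (u$1)\<^sup>2 - c u * (u$2)\<^sup>2)"
  proof (rule sum.cong)
    fix u assume "u \<in> U"
    then have "u \<bullet> u = 1" using U by (auto simp: norm_eq_1)
    then have "(u$3)\<^sup>2 = 1 - (u$1)\<^sup>2 - (u$2)\<^sup>2" by (simp add: inner_vec_def sum_3 power2_eq_square)
    then show "c u * (u$3)\<^sup>2 = c u - c u * (u$1)\<^sup>2 - c u * (u$2)\<^sup>2"
      by (simp only: right_diff_distrib mult_1_right)
  qed simp
  then have q3: "(\<Sum>u\<in>U. c u * (u$3)\<^sup>2) = 1" using quads sc by (simp add: sum_subtractf)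
  have "(\<Sum>u\<in>U. c u * (u \<bullet> x)\<^sup>2) = x \<bullet> x" for x
  proof -
    have "(\<Sum>u\<in>U. c u * (u \<bullet> x)\<^sup>2) = (\<Sum>u\<in>U. (x$1)\<^sup>2 * (c u * (u$1)\<^sup>2) + (x$2)\<^sup>2 * (c u * (u$2)\<^sup>2)
      + (x$3)\<^sup>2 * (c u * (u$3)\<^sup>2) + 2 * x$1 * x$2 * (c u * (u$1 * u$2))
      + 2 * x$2 * x$3 * (c u * (u$2 * u$3)) + 2 * x$1 * x$3 * (c u * (u$1 * u$3)))"
      by (intro sum.cong) (simp_all add: inner_vec_def sum_3 power2_eq_square algebra_simps)
    also have "\<dots> = x \<bullet> x"
      by (simp add: sum.distrib sum_distrib_left[symmetric] quads q3)
        (simp add: inner_vec_def sum_3 power2_eq_square)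
    finally show ?thesis .
  qed
  moreover have "\<forall>u\<in>U. 0 \<le> c u" using l(1) U by (auto simp: c_def)
  ultimately show ?thesis using fin U sc by blast
qed

text \<open>Take for \<open>a\<close> a contact point of largest weight, which is at least \<open>3 / 6\<close>.
The remaining at most five contact points are padded to exactly five by zero vectors of weight zero.\<close>

lemma extremal_position_large_triple_product:
  fixes D :: "(real^3) set"
  assumes D: "compact D" "\<And>v. v \<in> D \<Longrightarrow> norm v \<le> 1" "0 \<in> D"
    and ext: "\<And>A::real^3^3. (\<And>v. v \<in> D \<Longrightarrow> norm (A *v v) \<le> 1) \<Longrightarrow> det A \<le> 1"
  shows "\<exists>x\<in>D. \<exists>y\<in>D. \<exists>z\<in>D. 1/2 \<le> (x \<bullet> (cross3 y z))\<^sup>2"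
proof -
  obtain U w where U: "finite U" "card U \<le> 6" "U \<subseteq> D \<inter> sphere 0 1" and w: "\<And>u. u \<in> U \<Longrightarrow> 0 \<le> w u" "sum w U = 3"
    and iso: "\<And>x. (\<Sum>u\<in>U. w u * (u \<bullet> x)\<^sup>2) = x \<bullet> x"
    using extremal_position_decomposition[OF D(1,2) ext] by blast
  have ne: "U \<noteq> {}" using w(2) by auto
  have "Max (w ` U) \<in> w ` U" using U(1) ne by (intro Max_in) auto
  then obtain a where a: "a \<in> U" "w a = Max (w ` U)" by auto
  have max: "w u \<le> w a" if "u \<in> U" for u unfolding a(2) using U(1) that by (intro Max_ge) auto
  have half: "1/2 \<le> w a"
  proof -
    have "3 \<le> real (card U) * w a" using sum_bounded_above[of U w "w a"] max w(2) by simp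
    also have "\<dots> \<le> 6 * w a" using U(2) w(1)[OF a(1)] by (intro mult_right_mono) auto
    finally show ?thesis by simp
  qed
  define Q where "Q = U - {a}"
  define n where "n = card Q"
  have Q: "finite Q" "n \<le> 5" using U a(1) by (auto simp: Q_def n_def)
  obtain f where f: "bij_betw f {..<n} Q"
    using ex_bij_betw_nat_finite[OF Q(1)] unfolding n_def lessThan_atLeast0 by auto
  define v where "v i = (if i < n then f i else 0)" for i
  define c where "c i = (if i < n then w (f i) else 0)" for i
  have fQ: "f i \<in> Q" if "i < n" for i using f that by (auto simp: bij_betw_def)
  have sum_c: "(\<Sum>i<5. c i * F (v i)) = (\<Sum>u\<in>Q. w u * F u)" for F :: "real^3 \<Rightarrow> real"
  proof -
    have "(\<Sum>i<5. c i * F (v i)) = (\<Sum>i<n. w (f i) * F (f i))"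
      using Q(2) by (intro sum.mono_neutral_cong_right) (auto simp: c_def v_def)
    also have "\<dots> = (\<Sum>u\<in>Q. w u * F u)" by (rule sum.reindex_bij_betw[OF f])
    finally show ?thesis .
  qed
  have split: "(\<Sum>u\<in>U. g u) = g a + (\<Sum>u\<in>Q. g u)" for g :: "real^3 \<Rightarrow> real"
    unfolding Q_def by (rule sum.remove[OF U(1) a(1)])
  have "\<exists>i<5. \<exists>j<5. 1/2 \<le> (a \<bullet> (cross3 (v i) (v j)))\<^sup>2"
  proof (rule isotropic_large_triple_product[where h = "w a" and c = c])
    show "w a * (a \<bullet> x)\<^sup>2 + (\<Sum>i<5. c i * (v i \<bullet> x)\<^sup>2) = x \<bullet> x" for x
      using iso[of x] unfolding split sum_c[of "\<lambda>u. (u \<bullet> x)\<^sup>2"] .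
    show "norm a = 1" using a(1) U(3) by auto
    show "0 \<le> c i \<and> c i \<le> w a" for i
      using fQ[of i] w(1) max half by (auto simp: c_def Q_def)
    show "(\<Sum>i<5. c i) = 3 - w a"
      using sum_c[of "\<lambda>_. 1"] split[of w] w(2) by simp
  qed (rule half)
  moreover have "v i \<in> D" for i
    using fQ[of i] U(3) D(3) by (auto simp: v_def Q_def)
  moreover have "a \<in> D" using a(1) U(3) by auto
  ultimately show ?thesis by blast
qed

text \<open>The matrices that map \<open>D\<close> into the unit ball form a compact set, because
\<open>D\<close> contains a ball. Small multiples of the identity show that the maximal determinant is
positive.\<close>

lemma exists_extremal_position:
  fixes D :: "(real^3) set"
  assumes D: "compact D" and int: "0 < r" "cball 0 r \<subseteq> D"
  shows "\<exists>T::real^3^3. 0 < det T \<and> (\<forall>v\<in>D. norm (T *v v) \<le> 1)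
    \<and> (\<forall>A::real^3^3. (\<forall>v\<in>D. norm (A *v v) \<le> 1) \<longrightarrow> det A \<le> det T)"
proof -
  define \<T> where "\<T> = {T :: real^3^3. \<forall>v\<in>D. norm (T *v v) \<le> 1}"
  have "bounded \<T>"
  proof (rule boundedI)
    fix T assume T: "T \<in> \<T>"
    have entry: "\<bar>T $ i $ j\<bar> \<le> 1 / r" for i j
    proof -
      have "r *\<^sub>R axis j 1 \<in> D" using int by (intro subsetD[OF int(2)]) (simp add: norm_axis_1)
      then have "norm (T *v (r *\<^sub>R axis j 1)) \<le> 1" using T by (auto simp: \<T>_def)
      then have "\<bar>(T *v (r *\<^sub>R axis j 1)) $ i\<bar> \<le> 1" using component_le_norm_cart order_trans by blast
      moreover have "(T *v (r *\<^sub>R axis j 1)) $ i = r * T $ i $ j"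
        by (simp add: matrix_vector_mult_scaleR matrix_vector_mult_basis column_def)
      ultimately show ?thesis using int(1) by (simp add: abs_mult field_simps)
    qed
    have "norm (T $ i) \<le> 3 / r" for i
    proof -
      have "norm (T $ i) \<le> (\<Sum>j\<in>UNIV. \<bar>T $ i $ j\<bar>)" by (rule norm_le_l1_cart)
      also have "\<dots> \<le> (\<Sum>j\<in>(UNIV::3 set). 1 / r)" by (intro sum_mono entry)
      finally show ?thesis by simp
    qed
    then have "(\<Sum>i\<in>UNIV. norm (T $ i)) \<le> (\<Sum>i\<in>(UNIV::3 set). 3 / r)" by (intro sum_mono)
    moreover have "norm T \<le> (\<Sum>i\<in>UNIV. norm (T $ i))" unfolding norm_vec_def by (intro L2_set_le_sum) auto
    ultimately show "norm T \<le> 9 / r" by simp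
  qed
  moreover have "closed \<T>"
  proof -
    have "\<T> = (\<Inter>v\<in>D. {T. norm (T *v v) \<le> 1})" by (auto simp: \<T>_def)
    moreover have "closed {T::real^3^3. norm (T *v v) \<le> 1}" for v
      unfolding matrix_vector_mult_def by (intro closed_Collect_le continuous_intros)
    ultimately show ?thesis by (simp add: closed_INT)
  qed
  ultimately have comp: "compact \<T>" by (simp add: compact_eq_bounded_closed)
  have cont: "continuous_on \<T> (\<lambda>T. det T)"
    unfolding det_3 by (intro continuous_intros)
  obtain B where B: "0 < B" "\<And>v. v \<in> D \<Longrightarrow> norm v \<le> B"
    using compact_imp_bounded[OF D] unfolding bounded_pos by auto
  have I: "mat (1 / B) \<in> \<T>"
  proof -
    have "(mat (1 / B) :: real^3^3) *v v = (1 / B) *\<^sub>R v" for v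
      by (simp add: matrix_vector_mult_def mat_def vec_eq_iff if_distrib[where f = "\<lambda>x. x * _"] cong: if_cong)
    then show ?thesis using B by (simp add: \<T>_def divide_le_eq)
  qed
  obtain T where T: "T \<in> \<T>" "\<And>A. A \<in> \<T> \<Longrightarrow> det A \<le> det T"
    using continuous_attains_sup[OF comp _ cont] I by blast
  have "0 < det (mat (1 / B) :: real^3^3)" using B(1) by (simp add: det_3 mat_def)
  also have "\<dots> \<le> det T" by (rule T(2)[OF I])
  finally show ?thesis using T by (intro exI[of _ T]) (auto simp: \<T>_def)
qed

section \<open>Volume of a convex body containing three segments\<close>

lemma power_integral_unit_interval:
  "(\<integral>\<^sup>+z. ennreal ((1 - z) ^ d) * indicator {0..1} z \<partial>lborel) = ennreal (1 / (real d + 1))"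
proof -
  have "(\<integral>\<^sup>+z. ennreal ((1 - z) ^ d) * indicator {0..1} z \<partial>lborel)
      = ennreal (- ((1 - 1) ^ Suc d) / (real d + 1) - - ((1 - 0) ^ Suc d) / (real d + 1))"
  proof (rule nn_integral_FTC_Icc)
    show "((\<lambda>z. - ((1 - z) ^ Suc d) / (real d + 1)) has_field_derivative (1 - x) ^ d) (at x)"
      for x :: real
    proof -
      have "((\<lambda>z. (1 - z) ^ Suc d) has_field_derivative - ((real d + 1) * (1 - x) ^ d)) (at x)"
        by (auto intro!: derivative_eq_intros simp del: power_Suc)
      from DERIV_cdivide[OF DERIV_minus[OF this], of "real d + 1"] show ?thesis
        by (simp del: power_Suc add: add_nonneg_eq_0_iff)
    qed
  qed auto
  then show ?thesis by simp
qed

lemma compact_slice: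
  fixes S :: "('a::euclidean_space \<times> 'b::euclidean_space) set"
  assumes "compact S"
  shows "compact (Pair p -` S)"
proof -
  have "Pair p -` S = snd ` (S \<inter> {p} \<times> UNIV)" by force
  moreover have "compact (S \<inter> {p} \<times> UNIV)" by (intro compact_Int_closed assms closed_Times) auto
  ultimately show ?thesis by (simp add: compact_continuous_image continuous_on_snd)
qed

text \<open>Replacing every chord of \<open>K\<close> parallel to the last axis by a segment of the same length
standing on the base \<open>fst ` K\<close> keeps the volume (Blaschke's shaking). The shaken body contains the
cone over the base with apex at height \<open>1\<close> above \<open>p0\<close>. The set \<open>C\<close> is
this cone; its slices in both directions are compared with those of \<open>K\<close> through Fubini's theorem,
without forming the shaken body.\<close>

lemma emeasure_convex_ge_cone:
  fixes K :: "('a::euclidean_space \<times> real) set"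
  assumes K: "compact K" "convex K" and seg: "(p0, z0) \<in> K" "(p0, z0 + 1) \<in> K"
  shows "emeasure lborel (fst ` K) * ennreal (1 / (real DIM('a) + 1)) \<le> emeasure lborel K"
proof -
  let ?d = "DIM('a)"
  define L where "L = fst ` K"
  have L: "compact L" unfolding L_def by (intro compact_continuous_image continuous_intros K)
  have meas: "S \<in> sets borel" if "compact S" for S :: "'b::euclidean_space set"
    using that by (simp add: borel_compact)
  have leb: "emeasure lebesgue S = emeasure lborel S" if "compact S" for S :: "'a set"
    using meas[OF that] by (simp add: emeasure_completion sets_completionI_sets)
  have pair: "S \<in> sets (lborel \<Otimes>\<^sub>M lborel)" if "compact S" for S :: "('a \<times> real) set"
    unfolding lborel_prod using meas[OF that] by simp
  define C where "C = (\<lambda>(z, q). ((1 - z) *\<^sub>R q + z *\<^sub>R p0, z)) ` ({0..1} \<times> L)"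
  have C: "compact C" unfolding C_def case_prod_unfold
    by (intro compact_continuous_image continuous_intros compact_Times L) auto
  have C_iff: "(p, z) \<in> C \<longleftrightarrow> z \<in> {0..1} \<and> p \<in> (\<lambda>q. (1 - z) *\<^sub>R q + z *\<^sub>R p0) ` L" for p z
    unfolding C_def by (auto simp: image_iff)
  have slice_C: "emeasure lborel (Pair p -` C) \<le> emeasure lborel (Pair p -` K)" for p
  proof (cases "Pair p -` C = {}")
    case True then show ?thesis by simp
  next
    case False
    note compact_slice[OF C, of p]
    from compact_attains_sup[OF this False] obtain s where s: "(p, s) \<in> C" and le: "\<And>z. (p, z) \<in> C \<Longrightarrow> z \<le> s"
      by auto
    from s obtain q where q: "q \<in> L" "p = (1 - s) *\<^sub>R q + s *\<^sub>R p0" "0 \<le> s" "s \<le> 1"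
      by (auto simp: C_def)
    then obtain y where y: "(q, y) \<in> K" by (auto simp: L_def)
    \<comment> \<open>Over p, the body contains the point of K above q averaged with the whole unit segment above p0, so a segment of length s.\<close>
    have "(1 - s) *\<^sub>R (q, y) + s *\<^sub>R (p0, z0) \<in> K" "(1 - s) *\<^sub>R (q, y) + s *\<^sub>R (p0, z0 + 1) \<in> K"
      by (rule convexD[OF K(2)]; use q y seg in simp)+
    then have ends: "(p, (1 - s) * y + s * z0) \<in> K" "(p, (1 - s) * y + s * z0 + s) \<in> K"
      unfolding q(2) by (simp_all add: distrib_left add.assoc)
    define w where "w = (1 - s) * y + s * z0"
    have "{w..w + s} \<subseteq> Pair p -` K"
    proof
      fix z assume z: "z \<in> {w..w + s}"
      have cv: "convex (Pair p -` K)"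
      proof (rule convexI)
        fix a b u v :: real
        assume ab: "a \<in> Pair p -` K" "b \<in> Pair p -` K" and uv: "0 \<le> u" "0 \<le> v" "u + v = 1"
        have "u *\<^sub>R (p, a) + v *\<^sub>R (p, b) \<in> K" using ab uv by (intro convexD[OF K(2)]) auto
        then show "u *\<^sub>R a + v *\<^sub>R b \<in> Pair p -` K"
          using uv by (simp add: scaleR_left_distrib[symmetric])
      qed
      have "closed_segment w (w + s) \<subseteq> Pair p -` K"
        by (rule closed_segment_subset) (use cv ends in \<open>auto simp: w_def\<close>)
      then show "z \<in> Pair p -` K" using z q by (auto simp: closed_segment_eq_real_ivl)
    qed
    moreover have "Pair p -` K \<in> sets borel" by (rule meas[OF compact_slice[OF K(1)]])
    ultimately have "emeasure lborel {w..w + s} \<le> emeasure lborel (Pair p -` K)"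
      by (intro emeasure_mono) auto
    moreover have "emeasure lborel (Pair p -` C) \<le> emeasure lborel {0..s}"
      using le C_iff by (intro emeasure_mono) auto
    ultimately show ?thesis using q by simp
  qed
  have slice_z: "emeasure lborel ((\<lambda>p. (p, z)) -` C) = (ennreal ((1 - z) ^ ?d) * indicator {0..1} z) * emeasure lborel L" for z
  proof (cases "z \<in> {0..1}")
    case True
    have "(\<lambda>p. (p, z)) -` C = (\<lambda>q. (1 - z) *\<^sub>R q + z *\<^sub>R p0) ` L"
      using True by (auto simp only: C_iff vimage_def)
    moreover have "compact ((\<lambda>q. (1 - z) *\<^sub>R q + z *\<^sub>R p0) ` L)"
      by (intro compact_continuous_image continuous_intros L)
    ultimately show ?thesis
      using emeasure_lebesgue_affine[of "1 - z" "z *\<^sub>R p0" L] True meas L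
      by (simp add: leb ennreal_power)
  next
    case False
    then have "(\<lambda>p. (p, z)) -` C = {}" by (auto simp only: C_iff vimage_def)
    then show ?thesis using False by simp
  qed
  have "emeasure lborel L * ennreal (1 / (real ?d + 1))
      = (\<integral>\<^sup>+z. ennreal ((1 - z) ^ ?d) * indicator {0..1} z * emeasure lborel L \<partial>lborel)"
    by (subst nn_integral_multc, simp) (simp only: power_integral_unit_interval mult.commute[of "emeasure lborel L"])
  also have "\<dots> = emeasure (lborel \<Otimes>\<^sub>M lborel) C"
    by (simp only: lborel_pair.emeasure_pair_measure_alt2[OF pair[OF C]] slice_z)
  also have "\<dots> = (\<integral>\<^sup>+p. emeasure lborel (Pair p -` C) \<partial>lborel)"
    by (rule lborel.emeasure_pair_measure_alt[OF pair[OF C]])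
  also have "\<dots> \<le> (\<integral>\<^sup>+p. emeasure lborel (Pair p -` K) \<partial>lborel)"
    by (intro nn_integral_mono slice_C)
  also have "\<dots> = emeasure (lborel \<Otimes>\<^sub>M lborel) K"
    by (rule lborel.emeasure_pair_measure_alt[OF pair[OF K(1)], symmetric])
  finally show ?thesis by (simp add: lborel_prod L_def)
qed

text \<open>The cone bound splits off one coordinate of a product type, so three-dimensional vectors are carried
over to nested pairs.\<close>

definition triple_vec :: "(real \<times> real) \<times> real \<Rightarrow> real^3" where
  "triple_vec w = vector [fst (fst w), snd (fst w), snd w]"

lemma prod_Basis_3: "(\<Prod>b\<in>Basis. (x::real^3) \<bullet> b) = x$1 * x$2 * x$3"
proof -
  have B: "Basis = (\<lambda>i. axis i 1 :: real^3) ` UNIV" by (auto simp: Basis_vec_def)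
  have "inj (\<lambda>i. axis i 1 :: real^3)" by (auto intro!: injI simp: axis_eq_axis)
  then have "(\<Prod>b\<in>Basis. (x::real^3) \<bullet> b) = (\<Prod>i\<in>UNIV. x \<bullet> axis i 1)"
    unfolding B by (subst prod.reindex) (auto simp: o_def)
  also have "\<dots> = (\<Prod>i\<in>{1, 2, 3}. x $ i)" by (simp add: inner_axis UNIV_3[symmetric])
  finally show ?thesis by simp
qed

lemma measurable_triple_vec: "triple_vec \<in> borel_measurable borel"
proof (rule borel_measurable_continuous_onI)
  have "linear triple_vec"
    by (auto intro!: linearI simp: triple_vec_def vec_eq_iff forall_3)
  then show "continuous_on UNIV triple_vec"
    by (intro linear_continuous_on) (simp add: linear_conv_bounded_linear)
qed

lemma lborel_triple_vec: "lborel = distr lborel borel triple_vec"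
proof (rule lborel_eqI)
  fix l u :: "real^3" assume le: "\<And>b. b \<in> Basis \<Longrightarrow> l \<bullet> b \<le> u \<bullet> b"
  have le': "l $ i \<le> u $ i" for i using le[of "axis i 1"] by (auto simp: inner_axis Basis_vec_def)
  have "triple_vec -` box l u = box ((l$1, l$2), l$3) ((u$1, u$2), u$3)"
    by (auto simp: box_def triple_vec_def Basis_vec_def Basis_prod_def inner_axis forall_3 vector_3)
  then have "emeasure (distr lborel borel triple_vec) (box l u) = emeasure lborel (box ((l$1, l$2), l$3) ((u$1, u$2), u$3))"
    using measurable_triple_vec by (simp add: emeasure_distr)
  also have "\<dots> = ennreal ((u - l)$1 * (u - l)$2 * (u - l)$3)"
    using le' by (subst emeasure_lborel_box) (auto simp: Basis_prod_def)
  finally show "emeasure (distr lborel borel triple_vec) (box l u) = ennreal (\<Prod>b\<in>Basis. (u - l) \<bullet> b)"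
    by (simp add: prod_Basis_3)
qed simp

text \<open>Two applications of the cone bound reduce the volume to the length of the projection to the first
axis, with the factors \<open>1/3\<close> and \<open>1/2\<close>. Each projection still contains the segments in
the remaining directions.\<close>

lemma measure_axis_segments:
  fixes K :: "(real^3) set"
  assumes K: "compact K" "convex K" and seg: "\<And>i. \<exists>x\<in>K. x + axis i 1 \<in> K"
  shows "1/6 \<le> measure lebesgue K"
proof -
  define g where "g v = ((v$1, v$2), v$3)" for v :: "real^3"
  have tg: "triple_vec (g v) = v" "g (triple_vec w) = w" for v w
    by (simp_all add: g_def triple_vec_def vec_eq_iff forall_3)
  define K3 where "K3 = g ` K"
  have lin: "linear g" by (auto intro!: linearI simp: g_def)
  have K3: "compact K3" "convex K3"
    unfolding K3_def using K lin
    by (auto intro!: compact_continuous_image convex_linear_image linear_continuous_on simp: linear_conv_bounded_linear)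
  have K2: "compact (fst ` K3)" "convex (fst ` K3)"
    using K3 by (auto intro!: compact_continuous_image continuous_intros convex_linear_image linear_fst)
  have K1: "compact (fst ` fst ` K3)" "convex (fst ` fst ` K3)"
    using K2 by (auto intro!: compact_continuous_image continuous_intros convex_linear_image linear_fst)
  obtain a b c where abc: "a \<in> K" "a + axis 1 1 \<in> K" "b \<in> K" "b + axis 2 1 \<in> K" "c \<in> K" "c + axis 3 1 \<in> K"
    using seg by metis
  have s3: "((c$1, c$2), c$3) \<in> K3" "((c$1, c$2), c$3 + 1) \<in> K3"
    using imageI[OF abc(5), of g] imageI[OF abc(6), of g] by (auto simp: K3_def g_def axis_def)
  have s2: "(b$1, b$2) \<in> fst ` K3" "(b$1, b$2 + 1) \<in> fst ` K3"
    using imageI[OF abc(3), of "fst \<circ> g"] imageI[OF abc(4), of "fst \<circ> g"]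
    by (auto simp: K3_def g_def axis_def image_comp)
  have s1: "a$1 \<in> fst ` fst ` K3" "a$1 + 1 \<in> fst ` fst ` K3"
    using imageI[OF abc(1), of "fst \<circ> fst \<circ> g"] imageI[OF abc(2), of "fst \<circ> fst \<circ> g"]
    by (auto simp: K3_def g_def axis_def image_comp)
  have "{a$1..a$1 + 1} \<subseteq> fst ` fst ` K3"
    using closed_segment_subset[OF s1 K1(2)] by (simp add: closed_segment_eq_real_ivl)
  then have "emeasure lborel {a$1..a$1 + 1} \<le> emeasure lborel (fst ` fst ` K3)"
    using K1 by (intro emeasure_mono) (auto simp: borel_compact)
  then have "1 \<le> emeasure lborel (fst ` fst ` K3)" by simp
  then have "1 * ennreal (1/2) \<le> emeasure lborel (fst ` fst ` K3) * ennreal (1/2)" by (intro mult_right_mono) auto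
  also have "\<dots> \<le> emeasure lborel (fst ` K3)"
    using emeasure_convex_ge_cone[OF K2 s2] by simp
  finally have "1 * ennreal (1/2) * ennreal (1/3) \<le> emeasure lborel (fst ` K3) * ennreal (1/3)"
    by (intro mult_right_mono) auto
  also have "\<dots> \<le> emeasure lborel K3"
    using emeasure_convex_ge_cone[OF K3 s3] by simp
  also have "emeasure lborel K3 = emeasure lborel K"
  proof -
    have "triple_vec -` K = K3" by (force simp: K3_def tg image_iff)
    then have "emeasure (distr lborel borel triple_vec) K = emeasure lborel K3"
      using K measurable_triple_vec by (subst emeasure_distr) (auto simp: borel_compact)
    then show ?thesis by (simp add: lborel_triple_vec[symmetric])
  qed
  finally have "1 * ennreal (1/2) * ennreal (1/3) \<le> emeasure lborel K" .
  moreover have "ennreal (1/6) = ennreal (1/2 * (1/3))" by simp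
  moreover have "\<dots> = ennreal (1/2) * ennreal (1/3)" by (rule ennreal_mult) auto
  ultimately have "ennreal (1/6) \<le> emeasure lborel K" by (simp only: mult_1_left)
  moreover have "emeasure lborel K = ennreal (measure lebesgue K)"
  proof -
    have "emeasure lborel K = ennreal (measure lborel K)"
      using emeasure_compact_finite[OF K(1)] by (intro emeasure_eq_ennreal_measure) simp
    then show ?thesis using K by (simp add: borel_compact)
  qed
  ultimately show ?thesis by simp
qed

text \<open>The inverse of the matrix with the columns \<open>U $ i\<close> maps the three segments to unit
segments in axis directions.\<close>

lemma measure_ge_triple_product:
  fixes K :: "(real^3) set" and U :: "real^3^3"
  assumes K: "compact K" "convex K"
    and seg: "\<And>i. \<exists>x\<in>K. x + U $ i \<in> K"
  shows "\<bar>det U\<bar> / 6 \<le> measure lebesgue K"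
proof (cases "det U = 0")
  case False
  let ?A = "transpose U"
  have inv: "invertible ?A" using False by (simp add: invertible_det_nz)
  then obtain B where B: "?A ** B = mat 1" "B ** ?A = mat 1" by (auto simp: invertible_def)
  let ?K = "(\<lambda>x. B *v x) ` K"
  have lin: "linear (\<lambda>x. B *v x)" "linear (\<lambda>x. ?A *v x)" by (rule matrix_vector_mul_linear)+
  have K': "compact ?K" "convex ?K"
    using K lin(1) by (auto intro!: compact_continuous_image convex_linear_image linear_continuous_on simp: linear_conv_bounded_linear)
  have BU: "B *v (U $ i) = axis i 1" for i
  proof -
    have Ui: "U $ i = ?A *v axis i 1" by (simp add: matrix_vector_mult_basis row_transpose[symmetric] row_def column_def transpose_def vec_eq_iff)
    have "B *v (U $ i) = (B ** ?A) *v axis i 1" unfolding Ui by (simp only: matrix_vector_mul_assoc)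
    then show ?thesis by (simp only: B matrix_vector_mul_lid)
  qed
  have "1/6 \<le> measure lebesgue ?K"
  proof (rule measure_axis_segments[OF K'])
    fix i
    obtain x where "x \<in> K" "x + U $ i \<in> K" using seg by blast
    then show "\<exists>x\<in>?K. x + axis i 1 \<in> ?K"
      by (intro bexI[of _ "B *v x"]) (auto simp: BU[symmetric] matrix_vector_right_distrib[symmetric])
  qed
  then have "\<bar>det U\<bar> * (1/6) \<le> \<bar>det U\<bar> * measure lebesgue ?K" by (intro mult_left_mono) auto
  also have "\<dots> = measure lebesgue ((\<lambda>x. ?A *v x) ` ?K)"
    using measure_linear_image[OF lin(2) lmeasurable_compact[OF K'(1)]]
    by (simp only: matrix_of_matrix_vector_mul det_transpose)
  also have "(\<lambda>x. ?A *v x) ` ?K = K"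
    by (simp only: image_image matrix_vector_mul_assoc B matrix_vector_mul_lid image_ident)
  finally show ?thesis by simp
qed simp

section \<open>The reverse isodiametric inequality\<close>

theorem theorem1p1:
  fixes K :: "(real ^ 3) set"
  assumes "convex_body K"
  shows "\<exists>T :: real ^ 3 \<Rightarrow> real ^ 3. linear T \<and> bij T \<and>
    measure lebesgue (T ` K) \<ge> sqrt 2 / 12 * diameter (T ` K) ^ 3"
proof -
  have K: "compact K" "convex K" "interior K \<noteq> {}" using assms by (auto simp: convex_body_def)
  \<comment> \<open>All differences of points of K; its image is in the unit ball iff the image of K has diameter at most 1.\<close>
  define D where "D = {x - y | x y. x \<in> K \<and> y \<in> K}"
  have D: "compact D" unfolding D_def by (intro compact_differences K)
  obtain x0 r where x0: "0 < r" "cball x0 r \<subseteq> K"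
    using K(3) by (auto simp: mem_interior_cball)
  have "cball 0 r \<subseteq> D"
  proof
    fix v :: "real^3" assume "v \<in> cball 0 r"
    then have "x0 + v \<in> K" "x0 \<in> K" using x0 by (auto simp: dist_norm)
    then show "v \<in> D" unfolding D_def by (intro CollectI exI[of _ "x0 + v"] exI[of _ x0]) auto
  qed
  then obtain M :: "real^3^3" where M: "0 < det M" "\<And>v. v \<in> D \<Longrightarrow> norm (M *v v) \<le> 1"
    and ext: "\<And>A::real^3^3. (\<And>v. v \<in> D \<Longrightarrow> norm (A *v v) \<le> 1) \<Longrightarrow> det A \<le> det M"
    using exists_extremal_position[OF D x0(1)] by blast
  let ?T = "\<lambda>x. M *v x"
  let ?K = "?T ` K"
  have lin: "linear ?T" by (rule matrix_vector_mul_linear)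
  have bij: "bij ?T"
    using M(1) by (simp add: invertible_eq_bij[symmetric] invertible_det_nz)
  have K': "compact ?K" "convex ?K"
    using K lin by (auto intro!: compact_continuous_image convex_linear_image linear_continuous_on simp: linear_conv_bounded_linear)
  have ne: "K \<noteq> {}" using K(3) by auto
  have D': "compact (?T ` D)"
    using D lin by (auto intro!: compact_continuous_image linear_continuous_on simp: linear_conv_bounded_linear)
  have "\<exists>x\<in>?T ` D. \<exists>y\<in>?T ` D. \<exists>z\<in>?T ` D. 1/2 \<le> (x \<bullet> (cross3 y z))\<^sup>2"
  proof (rule extremal_position_large_triple_product[OF D'])
    show "norm v \<le> 1" if "v \<in> ?T ` D" for v using that M(2) by auto
    obtain x where "x \<in> K" using ne by auto
    then have "0 \<in> D" by (force simp: D_def)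
    then show "0 \<in> ?T ` D" by (auto intro!: image_eqI[of _ _ 0])
    show "det A \<le> 1" if A: "\<And>v. v \<in> ?T ` D \<Longrightarrow> norm (A *v v) \<le> 1" for A :: "real^3^3"
    proof -
      have "det (A ** M) \<le> det M"
        by (rule ext) (use A in \<open>auto simp: matrix_vector_mul_assoc[symmetric]\<close>)
      then show ?thesis using M(1) by (simp add: det_mul)
    qed
  qed
  then obtain x y z where xyz: "x \<in> ?T ` D" "y \<in> ?T ` D" "z \<in> ?T ` D" and big: "1/2 \<le> (x \<bullet> (cross3 y z))\<^sup>2"
    by blast
  have seg: "\<exists>p\<in>?K. p + u \<in> ?K" if "u \<in> ?T ` D" for u
  proof -
    obtain d where d: "d \<in> D" "u = M *v d" using \<open>u \<in> ?T ` D\<close> by blast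
    then obtain p q where "p \<in> K" "q \<in> K" "u = M *v (p - q)" unfolding D_def by blast
    then show ?thesis by (intro bexI[of _ "M *v q"]) (auto simp: matrix_vector_right_distrib[symmetric])
  qed
  \<comment> \<open>For each row of this matrix, the image of K contains a translate of the segment from 0 to the row.\<close>
  define U :: "real^3^3" where "U = vector [x, y, z]"
  have "\<forall>i. \<exists>p\<in>?K. p + U $ i \<in> ?K"
    using seg xyz by (simp add: forall_3 U_def)
  then have vol: "\<bar>det U\<bar> / 6 \<le> measure lebesgue ?K"
    by (intro measure_ge_triple_product[OF K']) auto
  have "(1 / sqrt 2)\<^sup>2 \<le> \<bar>det U\<bar>\<^sup>2"
    using big by (simp add: U_def dot_cross_det power_divide)
  then have "1 / sqrt 2 \<le> \<bar>det U\<bar>" by (rule power2_le_imp_le) simp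
  moreover have "1 / sqrt 2 = sqrt 2 / 2" by (simp add: field_simps)
  ultimately have "sqrt 2 / 12 \<le> measure lebesgue ?K" using vol by simp
  moreover have "diameter ?K \<le> 1"
  proof (rule diameter_le)
    show "norm (a - b) \<le> 1" if ab: "a \<in> ?K" "b \<in> ?K" for a b
    proof -
      obtain p q where "p \<in> K" "q \<in> K" "a = M *v p" "b = M *v q" using ab by auto
      then have "p - q \<in> D" "a - b = M *v (p - q)"
        by (auto simp: D_def matrix_vector_mult_diff_distrib)
      then show ?thesis using M(2) by simp
    qed
  qed simp
  then have "diameter ?K ^ 3 \<le> 1"
    using diameter_ge_0[OF compact_imp_bounded[OF K'(1)]] by (intro power_le_one)
  then have "sqrt 2 / 12 * diameter ?K ^ 3 \<le> sqrt 2 / 12 * 1" by (intro mult_left_mono) auto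
  ultimately have "measure lebesgue ?K \<ge> sqrt 2 / 12 * diameter ?K ^ 3" by linarith
  then show ?thesis using lin bij by blast
qed

end
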